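(* Let $p\ge 2$. Assume that there are $\alpha>0$ and real coefficients $(c_k)_{k\ge1}$ such that the weak error expansion $(WE_{\alpha,\bar R})$ holds for all $\bar R\ge 1$, and that $Y_0\in L^p$. Assume furthermore the $L^p$-strong error rate assumption: there exist $\beta>0$ and $V_1^{(p)}\ge 0$ such that $$\|Y_h-Y_0\|_p^p=\mathbf{E}\big[|Y_h-Y_0|^p\big]\le V_1^{(p)}\,h^{\frac{\beta}{2}p},\qquad h\in\mathcal H .$$ Then, for every sequence of positive real numbers $(\varepsilon_k)_{k\ge1}$ such that $\sum_{k\ge1}\varepsilon_k^p<+\infty$, both the MLMC and the ML2R estimators satisfy $$I_\pi^N(\varepsilon_k)\xrightarrow{a.s.} I_0=\mathbf{E}[Y_0]\qquad\text{as }k\to+\infty .$$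
   Context: Setting. $(\Omega,\mathcal A,\mathbf P)$ is a probability space, $\mathbf h>0$, $\mathcal H=\{\mathbf h/n : n\ge 1\}$. $Y_0\in L^2(\mathbf P)$ is a real random variable with $\mathrm{Var}(Y_0)>0$ and $(Y_h)_{h\in\mathcal H}$ is a family of real random variables in $L^2(\mathbf P)$ with $\lim_{h\to0}\|Y_h-Y_0\|_2=0$. $M\ge2$ is a fixed integer and $n_j=M^{j-1}$, $j\ge1$. $\lceil x\rceil$ is the unique positive integer $n$ with $n-1<x\le n$ (for $x>0$). Weak error $(WE_{\alpha,\bar R})$: $\mathbf E[Y_h]-\mathbf E[Y_0]=\sum_{k=1}^{\bar R}c_kh^{\alpha k}+h^{\alpha\bar R}\eta_{\bar R}(h)$ with $\lim_{h\to0}\eta_{\bar R}(h)=0$. Strong error $(SE_\beta)$: $\mathbf E[|Y_h-Y_0|^2]\le V_1h^\beta$ for all $h\in\mathcal H$ (the $L^p$-strong error assumption with $p\ge 2$ implies it). A constant $V_1>0$ for which it holds is fixed. Standing assumptions: $2\alpha\ge\beta$; for MLMC, $c_1\ne0$; for ML2R, $\widetilde c_\infty:=\lim_{R\to\infty}|c_R|^{1/R}$ exists in $(0,+\infty)$. Estimators. Let $Y^{(j)}=(Y^{(j)}_h)_{h\in\mathcal H\cup\{0\}}$, $j\ge1$, be independent copies of the family $(Y_h)_{h\in\mathcal H\cup\{0\}}$ and let $(Y^{(j),k})_{k\ge1}$, $j\ge 1$, be independent sequences of independent copies of $Y^{(j)}$ (these do not depend on $\varepsilon$). For $h\in\mathcal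 H$, $R\ge2$, $q=(q_1,\dots,q_R)\in(0,1)^R$ with $\sum_jq_j=1$, and $N>0$, put $h_j=h/n_j$, $N_j=\lceil Nq_j\rceil$, $\pi=(h,R,q)$ and $$I_\pi^N=\frac1{N_1}\sum_{k=1}^{N_1}Y_h^{(1),k}+\sum_{j=2}^R\frac{W_j^R}{N_j}\sum_{k=1}^{N_j}\big(Y_{h_j}^{(j),k}-Y_{h_{j-1}}^{(j),k}\big),$$ with $W_j^R=1$ for MLMC and $W_j^R=\mathbf W_j^R$ for ML2R, where $\mathbf W_j^R=\sum_{r=j}^R\mathbf w_r$ and $(\mathbf w_1,\dots,\mathbf w_R)$ is the solution of the Vandermonde system $\sum_{r=1}^R\mathbf w_r=1$, $\sum_{r=1}^R\mathbf w_r n_r^{-\alpha i}=0$ for $i=1,\dots,R-1$. Parameters as functions of $\varepsilon>0$ (small enough that $R(\varepsilon)\ge2$). Put $\theta=\sqrt{V_1/\mathrm{Var}(Y_0)}$, $\underline C_{M,\beta}=\frac{1+M^{\beta/2}}{\sqrt{1+M^{-1}}}$, $\bar C_{M,\beta}=(1+M^{\beta/2})\sqrt{1+M^{-1}}$. ML2R: $R(\varepsilon)=\Big\lceil \kappa+\sqrt{\kappa^2+\frac{2\log(\sqrt{1+4\alpha}/\varepsilon)}{\alpha\log M}}\Big\rceil$ with $\kappa=\frac12+\frac{\log(\widetilde c_\infty^{1/\alpha}\mathbf h)}{\log M}$; $h(\varepsilon)=\mathbf h/\big\lceil\mathbf h(1+2\alpha R)^{\frac1{2\alpha R}}\widetilde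 c_\infty^{1/\alpha}\varepsilon^{-\frac1{\alpha R}}M^{-\frac{R-1}2}\big\rceil$. MLMC: $R(\varepsilon)=\Big\lceil1+\frac{\log(|c_1|^{1/\alpha}\mathbf h)}{\log M}+\frac{\log(\sqrt{1+2\alpha}/\varepsilon)}{\alpha\log M}\Big\rceil$; $h(\varepsilon)=\mathbf h/\big\lceil\mathbf h(1+2\alpha)^{\frac1{2\alpha}}|c_1|^{1/\alpha}\varepsilon^{-\frac1\alpha}M^{-(R-1)}\big\rceil$. For both, with $R=R(\varepsilon)$, $h=h(\varepsilon)$: $q_1=\mu^*(1+\theta h^{\beta/2})$, $q_j=\mu^*\theta h^{\beta/2}\underline C_{M,\beta}|W_j^R|M^{-\frac{1+\beta}2(j-1)}$ for $2\le j\le R$, with $\mu^*=\mu^*(\varepsilon)$ such that $\sum_{j=1}^Rq_j=1$; and $$N(\varepsilon)=\rho\,\frac{\mathrm{Var}(Y_0)\Big(1+\theta h^{\beta/2}+\theta h^{\beta/2}\bar C_{M,\beta}\sum_{j=2}^R|W_j^R|M^{\frac{1-\beta}2(j-1)}\Big)}{\varepsilon^2\mu^*},$$ where $\rho=1+\frac1{2\alpha R}$ for ML2R and $\rho=1+\frac1{2\alpha}$ for MLMC. Finally $I_\pi^N(\varepsilon):=I_{\pi(\varepsilon)}^{N(\varepsilon)}$ with $\pi(\varepsilon)=(h(\varepsilon),R(\varepsilon),q(\varepsilon))$. *)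

theory Defs
  imports "HOL-Probability.Probability"
begin

section \<open>Setting\<close>

definition step_grid :: "real \<Rightarrow> real set" where
  "step_grid hmax = {hmax / real n | n. n \<ge> 1}"

text \<open>
  A family \<open>Y\<close> indexed by the steps and by \<open>0\<close> (the limit variable) is a function
  \<^typ>\<open>real \<Rightarrow> 'a \<Rightarrow> real\<close>; only the indices in \<open>insert 0 (step_grid hmax)\<close> matter.
  Independence and equality in law of families are understood for the induced random elements
  of the product space, i.e. jointly in all steps.
\<close>

abbreviation path_space :: "real \<Rightarrow> (real \<Rightarrow> real) measure" where
  "path_space hmax \<equiv> PiM (insert 0 (step_grid hmax)) (\<lambda>_. borel)"

definition path :: "real \<Rightarrow> (real \<Rightarrow> 'a \<Rightarrow> real) \<Rightarrow> 'a \<Rightarrow> (real \<Rightarrow> real)" where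
  "path hmax Y \<omega> = (\<lambda>h\<in>insert 0 (step_grid hmax). Y h \<omega>)"

text \<open>
  \<open>Yc j k\<close> is the \<open>k\<close>-th copy at level \<open>j\<close>. Independent copies \<open>Y\<^sup>(\<^sup>j\<^sup>)\<close> of \<open>Y\<close>, together with
  independent sequences of independent copies of each \<open>Y\<^sup>(\<^sup>j\<^sup>)\<close>, amount to one family
  indexed by \<open>(j, k)\<close> that is independent and has everywhere the law of \<open>Y\<close>.
\<close>

definition independent_copies ::
  "'a measure \<Rightarrow> real \<Rightarrow> (real \<Rightarrow> 'a \<Rightarrow> real) \<Rightarrow> (nat \<Rightarrow> nat \<Rightarrow> real \<Rightarrow> 'a \<Rightarrow> real) \<Rightarrow> bool" where
  "independent_copies P hmax Y Yc \<longleftrightarrow>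
     prob_space.indep_vars P (\<lambda>_. path_space hmax)
       (\<lambda>(j, k). path hmax (Yc j k)) ({1..} \<times> {1..}) \<and>
     (\<forall>j\<ge>1. \<forall>k\<ge>1. distr P (path_space hmax) (path hmax (Yc j k)) =
                       distr P (path_space hmax) (path hmax Y))"

definition weak_error ::
  "'a measure \<Rightarrow> real \<Rightarrow> (real \<Rightarrow> 'a \<Rightarrow> real) \<Rightarrow> real \<Rightarrow> (nat \<Rightarrow> real) \<Rightarrow> nat \<Rightarrow> bool" where
  "weak_error P hmax Y \<alpha> c Rb \<longleftrightarrow>
     (\<exists>\<eta> :: real \<Rightarrow> real.
        (\<forall>h\<in>step_grid hmax. (\<integral>\<omega>. Y h \<omega> \<partial>P) - (\<integral>\<omega>. Y 0 \<omega> \<partial>P) =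
           (\<Sum>k=1..Rb. c k * h powr (\<alpha> * real k)) + h powr (\<alpha> * real Rb) * \<eta> h) \<and>
        (\<eta> \<longlongrightarrow> 0) (at 0 within step_grid hmax))"

text \<open>
  Integrability is demanded explicitly because the Bochner integral of a non-integrable function
  is \<open>0\<close>, which would make the bound hold for free.
\<close>

definition strong_error ::
  "'a measure \<Rightarrow> real \<Rightarrow> (real \<Rightarrow> 'a \<Rightarrow> real) \<Rightarrow> real \<Rightarrow> real \<Rightarrow> real \<Rightarrow> bool" where
  "strong_error P hmax Y p \<beta> V \<longleftrightarrow>
     (\<forall>h\<in>step_grid hmax.
        integrable P (\<lambda>\<omega>. \<bar>Y h \<omega> - Y 0 \<omega>\<bar> powr p) \<and>
        (\<integral>\<omega>. \<bar>Y h \<omega> - Y 0 \<omega>\<bar> powr p \<partial>P) \<le> V * h powr (\<beta> / 2 * p))"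


section \<open>Estimators\<close>

definition refiner :: "nat \<Rightarrow> nat \<Rightarrow> real" where
  "refiner M j = real (M ^ (j - 1))"

text \<open>The system is a Vandermonde system with pairwise distinct nodes (if \<open>M \<ge> 2\<close> and
  \<open>\<alpha> > 0\<close>), so that its solution, taken to be \<^const>\<open>undefined\<close> outside \<open>{1..R}\<close>, is unique.\<close>

definition ml2r_weight :: "real \<Rightarrow> nat \<Rightarrow> nat \<Rightarrow> nat \<Rightarrow> real" where
  "ml2r_weight \<alpha> M R =
     (THE w. w \<in> extensional {1..R} \<and>
        (\<Sum>r=1..R. w r) = 1 \<and>
        (\<forall>i\<in>{1..R - 1}. (\<Sum>r=1..R. w r * refiner M r powr (- \<alpha> * real i)) = 0))"

definition ml2r_W :: "real \<Rightarrow> nat \<Rightarrow> nat \<Rightarrow> nat \<Rightarrow> real" where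
  "ml2r_W \<alpha> M R j = (\<Sum>r=j..R. ml2r_weight \<alpha> M R r)"

definition mlmc_W :: "nat \<Rightarrow> nat \<Rightarrow> real" where
  "mlmc_W R j = 1"

definition ml_estimator ::
  "(nat \<Rightarrow> nat \<Rightarrow> real \<Rightarrow> 'a \<Rightarrow> real) \<Rightarrow> nat \<Rightarrow> (nat \<Rightarrow> nat \<Rightarrow> real) \<Rightarrow>
   real \<Rightarrow> nat \<Rightarrow> (nat \<Rightarrow> real) \<Rightarrow> real \<Rightarrow> 'a \<Rightarrow> real" where
  "ml_estimator Yc M W h R q N \<omega> =
     (let Nj = (\<lambda>j. nat \<lceil>N * q j\<rceil>); hj = (\<lambda>j. h / refiner M j) in
       1 / real (Nj 1) * (\<Sum>k=1..Nj 1. Yc 1 k h \<omega>) +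
       (\<Sum>j=2..R. W R j / real (Nj j) *
          (\<Sum>k=1..Nj j. Yc j k (hj j) \<omega> - Yc j k (hj (j - 1)) \<omega>)))"


section \<open>Parameters\<close>

definition C_lower :: "nat \<Rightarrow> real \<Rightarrow> real" where
  "C_lower M \<beta> = (1 + real M powr (\<beta> / 2)) / sqrt (1 + 1 / real M)"

definition C_upper :: "nat \<Rightarrow> real \<Rightarrow> real" where
  "C_upper M \<beta> = (1 + real M powr (\<beta> / 2)) * sqrt (1 + 1 / real M)"

text \<open>The allocation \<open>q\<close> is \<open>\<mu>\<^sup>* * q_unnormalized\<close>, where \<open>\<mu>\<^sup>*\<close> makes it sum up to \<open>1\<close>.\<close>

definition q_unnormalized ::
  "real \<Rightarrow> real \<Rightarrow> nat \<Rightarrow> (nat \<Rightarrow> nat \<Rightarrow> real) \<Rightarrow> real \<Rightarrow> nat \<Rightarrow> nat \<Rightarrow> real" where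
  "q_unnormalized \<theta> \<beta> M W h R j =
     (if j = 1 then 1 + \<theta> * h powr (\<beta> / 2)
      else \<theta> * h powr (\<beta> / 2) * C_lower M \<beta> * \<bar>W R j\<bar> *
             real M powr (- ((1 + \<beta>) / 2) * (real j - 1)))"

definition mu_star ::
  "real \<Rightarrow> real \<Rightarrow> nat \<Rightarrow> (nat \<Rightarrow> nat \<Rightarrow> real) \<Rightarrow> real \<Rightarrow> nat \<Rightarrow> real" where
  "mu_star \<theta> \<beta> M W h R = 1 / (\<Sum>j=1..R. q_unnormalized \<theta> \<beta> M W h R j)"

definition q_opt ::
  "real \<Rightarrow> real \<Rightarrow> nat \<Rightarrow> (nat \<Rightarrow> nat \<Rightarrow> real) \<Rightarrow> real \<Rightarrow> nat \<Rightarrow> nat \<Rightarrow> real" where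
  "q_opt \<theta> \<beta> M W h R j = mu_star \<theta> \<beta> M W h R * q_unnormalized \<theta> \<beta> M W h R j"

definition N_opt ::
  "real \<Rightarrow> real \<Rightarrow> real \<Rightarrow> real \<Rightarrow> nat \<Rightarrow> (nat \<Rightarrow> nat \<Rightarrow> real) \<Rightarrow> real \<Rightarrow> nat \<Rightarrow> real \<Rightarrow> real" where
  "N_opt \<rho> v \<theta> \<beta> M W h R \<epsilon> =
     \<rho> * (v * (1 + \<theta> * h powr (\<beta> / 2) +
                \<theta> * h powr (\<beta> / 2) * C_upper M \<beta> *
                  (\<Sum>j=2..R. \<bar>W R j\<bar> * real M powr ((1 - \<beta>) / 2 * (real j - 1)))))
       / (\<epsilon>\<^sup>2 * mu_star \<theta> \<beta> M W h R)"

text \<open>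
  The formulas below are meant for small \<open>\<epsilon> > 0\<close>, where the arguments of the ceilings are
  positive and \<open>R \<ge> 2\<close>; for other \<open>\<epsilon>\<close> the values are irrelevant to limits as \<open>\<epsilon> \<rightarrow> 0\<close>.
  The argument \<open>ct\<close> stands for the limit of \<open>\<bar>c\<^sub>R\<bar>\<^sup>1\<^sup>/\<^sup>R\<close>.
\<close>

definition ml2r_R :: "real \<Rightarrow> nat \<Rightarrow> real \<Rightarrow> real \<Rightarrow> real \<Rightarrow> nat" where
  "ml2r_R \<alpha> M hmax ct \<epsilon> =
     (let \<kappa> = 1 / 2 + ln (ct powr (1 / \<alpha>) * hmax) / ln (real M) in
       nat \<lceil>\<kappa> + sqrt (\<kappa>\<^sup>2 + 2 * ln (sqrt (1 + 4 * \<alpha>) / \<epsilon>) / (\<alpha> * ln (real M)))\<rceil>)"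

definition ml2r_h :: "real \<Rightarrow> nat \<Rightarrow> real \<Rightarrow> real \<Rightarrow> real \<Rightarrow> real" where
  "ml2r_h \<alpha> M hmax ct \<epsilon> =
     (let R = real (ml2r_R \<alpha> M hmax ct \<epsilon>) in
       hmax / real_of_int \<lceil>hmax * (1 + 2 * \<alpha> * R) powr (1 / (2 * \<alpha> * R)) * ct powr (1 / \<alpha>) *
                \<epsilon> powr (- (1 / (\<alpha> * R))) * real M powr (- ((R - 1) / 2))\<rceil>)"

definition mlmc_R :: "real \<Rightarrow> nat \<Rightarrow> real \<Rightarrow> real \<Rightarrow> real \<Rightarrow> nat" where
  "mlmc_R \<alpha> M hmax c1 \<epsilon> =
     nat \<lceil>1 + ln (\<bar>c1\<bar> powr (1 / \<alpha>) * hmax) / ln (real M) +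
          ln (sqrt (1 + 2 * \<alpha>) / \<epsilon>) / (\<alpha> * ln (real M))\<rceil>"

definition mlmc_h :: "real \<Rightarrow> nat \<Rightarrow> real \<Rightarrow> real \<Rightarrow> real \<Rightarrow> real" where
  "mlmc_h \<alpha> M hmax c1 \<epsilon> =
     (let R = real (mlmc_R \<alpha> M hmax c1 \<epsilon>) in
       hmax / real_of_int \<lceil>hmax * (1 + 2 * \<alpha>) powr (1 / (2 * \<alpha>)) * \<bar>c1\<bar> powr (1 / \<alpha>) *
                \<epsilon> powr (- (1 / \<alpha>)) * real M powr (- (R - 1))\<rceil>)"

text \<open>In the two estimators, \<open>v\<close> is the variance of \<open>Y 0\<close> and \<open>V1\<close> the constant of the
  quadratic strong error bound.\<close>

definition ml2r_estimator ::
  "(nat \<Rightarrow> nat \<Rightarrow> real \<Rightarrow> 'a \<Rightarrow> real) \<Rightarrow> nat \<Rightarrow> real \<Rightarrow> real \<Rightarrow> real \<Rightarrow> real \<Rightarrow> real \<Rightarrow> real \<Rightarrow>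
   real \<Rightarrow> 'a \<Rightarrow> real" where
  "ml2r_estimator Yc M hmax \<alpha> \<beta> V1 v ct \<epsilon> =
     (let \<theta> = sqrt (V1 / v);
          W = ml2r_W \<alpha> M;
          R = ml2r_R \<alpha> M hmax ct \<epsilon>;
          h = ml2r_h \<alpha> M hmax ct \<epsilon>;
          \<rho> = 1 + 1 / (2 * \<alpha> * real R)
      in ml_estimator Yc M W h R (q_opt \<theta> \<beta> M W h R) (N_opt \<rho> v \<theta> \<beta> M W h R \<epsilon>))"

definition mlmc_estimator ::
  "(nat \<Rightarrow> nat \<Rightarrow> real \<Rightarrow> 'a \<Rightarrow> real) \<Rightarrow> nat \<Rightarrow> real \<Rightarrow> real \<Rightarrow> real \<Rightarrow> real \<Rightarrow> real \<Rightarrow> real \<Rightarrow>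
   real \<Rightarrow> 'a \<Rightarrow> real" where
  "mlmc_estimator Yc M hmax \<alpha> \<beta> V1 v c1 \<epsilon> =
     (let \<theta> = sqrt (V1 / v);
          W = mlmc_W;
          R = mlmc_R \<alpha> M hmax c1 \<epsilon>;
          h = mlmc_h \<alpha> M hmax c1 \<epsilon>;
          \<rho> = 1 + 1 / (2 * \<alpha>)
      in ml_estimator Yc M W h R (q_opt \<theta> \<beta> M W h R) (N_opt \<rho> v \<theta> \<beta> M W h R \<epsilon>))"

end

theory Submission
  imports Defs
begin

text \<open>
  Both estimators are split into their mean and a centred fluctuation.

  The fluctuation is a sum of independent centred variables, one for each sample of each level. For
  \<open>p \<ge> 2\<close> the space \<open>L\<^sup>p\<close> has type 2, that is, the squared \<open>L\<^sup>p\<close> norm of such a sum is at most a constant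
  times the sum of the squared \<open>L\<^sup>p\<close> norms (\<open>moment_sum_indep_centered_le\<close>). By the strong error
  assumption the correction at step \<open>h / n\<^sub>j\<close> has \<open>L\<^sup>p\<close> norm of order \<open>(h / n\<^sub>j) powr (\<beta> / 2)\<close>, which is also
  the order of the \<open>L\<^sup>2\<close> bound from which the sample allocation is designed. Therefore the sample sizes
  that keep the variance of order \<open>\<epsilon>\<^sup>2\<close> keep the \<open>p\<close>-th moment of the fluctuation of order \<open>\<epsilon> powr p\<close>, with
  a constant independent of the weights, the depth \<open>R\<close> and the coarse step \<open>h\<close>
  (\<open>variance_budget_bound\<close>, \<open>estimator_deviation_le\<close>). Summability of \<open>\<epsilon>\<^sub>k powr p\<close> makes the fluctuations
  vanish almost surely (\<open>AE_tendsto_zero_of_summable_moments\<close>).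

  The mean is an average \<open>\<Sum>r. w\<^sub>r * E[Y (h / n\<^sub>r)]\<close> with weights of total mass \<open>1\<close>. The strong error bounds the
  error of the \<open>r\<close>-th mean by a multiple of \<open>\<gamma> ^ (r - 1)\<close> with \<open>\<gamma> = M powr (- \<beta> / 2)\<close>, uniformly in \<open>h\<close>. The
  weights satisfy \<open>\<bar>w\<^sub>r\<bar> \<le> B * \<gamma> ^ (R - r)\<close>: for MLMC all the mass sits at \<open>r = R\<close>, and for ML2R the weights
  are Lagrange polynomials at \<open>0\<close> for geometric nodes of ratio \<open>M powr (- \<alpha>) \<le> \<gamma>\<close>
  (\<open>ml2r_weight_eq\<close>, \<open>geometric_lagrange_weight_le\<close>). The bias is thus of order
  \<open>R * \<gamma> ^ (R - 1)\<close> (\<open>estimator_bias_le\<close>) and tends to \<open>0\<close>, because the depth \<open>R\<close> tends to infinity as \<open>\<epsilon>\<close>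
  tends to \<open>0\<close>.
\<close>

section \<open>Power inequalities\<close>

lemma exp_le_quadratic:
  fixes x :: real
  assumes "\<bar>x\<bar> \<le> 1"
  shows "exp x \<le> 1 + x + x\<^sup>2"
proof (cases "x \<ge> 0")
  case True
  then show ?thesis using assms exp_bound[of x] by simp
next
  case False
  have "1 - x \<le> exp (- x)" using exp_ge_add_one_self[of "-x"] by simp
  hence "exp x * (1 - x) \<le> 1"
    by (metis exp_ge_zero exp_minus_inverse mult_left_mono)
  moreover have "1 \<le> (1 + x + x\<^sup>2) * (1 - x)"
  proof -
    have "(1 + x + x\<^sup>2) * (1 - x) = 1 - x * x\<^sup>2" by (simp add: algebra_simps power2_eq_square)
    moreover have "x * x\<^sup>2 \<le> 0" using False by (simp add: mult_nonpos_nonneg)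
    ultimately show ?thesis by simp
  qed
  ultimately have "exp x * (1 - x) \<le> (1 + x + x\<^sup>2) * (1 - x)" by linarith
  thus ?thesis using False by (simp add: mult_le_cancel_right)
qed

definition taylor_const :: "real \<Rightarrow> real" where
  "taylor_const p = (p + 1) powr p + p powr p"

lemma taylor_const_ge:
  assumes "p \<ge> 2"
  shows "taylor_const p \<ge> p\<^sup>2" and "taylor_const p \<ge> 1"
proof -
  have "p powr 2 \<le> p powr p" using assms by (intro powr_mono) auto
  hence *: "p\<^sup>2 \<le> p powr p" using assms by simp
  thus "taylor_const p \<ge> p\<^sup>2" by (simp add: taylor_const_def add_increasing)
  moreover have "1 \<le> p\<^sup>2" using assms by simp
  ultimately show "taylor_const p \<ge> 1" by linarith
qed

text \<open>
  A second-order Taylor bound without derivatives. If \<open>p * \<bar>b\<bar> \<le> \<bar>a\<bar>\<close> and \<open>a \<noteq> 0\<close>, then \<open>t = b / a\<close> satisfies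
  \<open>(1 + t) powr p \<le> exp (p * t)\<close>, and the exponential is below its quadratic bound because
  \<open>\<bar>p * t\<bar> \<le> 1\<close>. Otherwise \<open>a\<close> is dominated by \<open>p * \<bar>b\<bar>\<close>, and both the left-hand side and the linear
  term are multiples of \<open>\<bar>b\<bar> powr p\<close>; the constant collects these two multiples.
\<close>

lemma powr_abs_add_le_taylor:
  fixes a b p :: real
  assumes p: "p \<ge> 2"
  shows "\<bar>a + b\<bar> powr p \<le> \<bar>a\<bar> powr p + p * (sgn a * \<bar>a\<bar> powr (p - 1)) * b
           + taylor_const p * (\<bar>a\<bar> powr (p - 2) * b\<^sup>2 + \<bar>b\<bar> powr p)"
proof (cases "p * \<bar>b\<bar> \<le> \<bar>a\<bar> \<and> a \<noteq> 0")
  case True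
  define t where "t = b / a"
  have pt: "\<bar>p * t\<bar> \<le> 1" using True p by (auto simp: t_def abs_mult)
  have t1: "\<bar>t\<bar> \<le> 1/2"
  proof -
    have "2 * \<bar>t\<bar> \<le> p * \<bar>t\<bar>" using p by (intro mult_right_mono) auto
    thus ?thesis using pt p by (simp add: abs_mult)
  qed
  have "\<bar>a + b\<bar> = \<bar>a\<bar> * (1 + t)"
  proof -
    have "a + b = a * (1 + t)" using True by (simp add: t_def field_simps)
    thus ?thesis using t1 by (simp add: abs_mult)
  qed
  hence "\<bar>a + b\<bar> powr p = \<bar>a\<bar> powr p * (1 + t) powr p" using t1 by (simp add: powr_mult)
  also have "(1 + t) powr p \<le> 1 + p * t + (p * t)\<^sup>2"
  proof -
    have "(1 + t) powr p = exp (p * ln (1 + t))" using t1 by (simp add: powr_def)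
    also have "\<dots> \<le> exp (p * t)"
      using t1 p ln_add_one_self_le_self2[of t] by (auto intro!: mult_left_mono)
    also have "\<dots> \<le> 1 + p * t + (p * t)\<^sup>2" by (rule exp_le_quadratic[OF pt])
    finally show ?thesis .
  qed
  also have "\<bar>a\<bar> powr p * (1 + p * t + (p * t)\<^sup>2)
      = \<bar>a\<bar> powr p + p * (sgn a * \<bar>a\<bar> powr (p - 1)) * b + p\<^sup>2 * (\<bar>a\<bar> powr (p - 2) * b\<^sup>2)"
  proof -
    have 1: "\<bar>a\<bar> powr p * t = sgn a * \<bar>a\<bar> powr (p - 1) * b"
      using True by (auto simp: t_def powr_diff field_simps sgn_if)
    have 2: "\<bar>a\<bar> powr p * t\<^sup>2 = \<bar>a\<bar> powr (p - 2) * b\<^sup>2"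
      using True by (auto simp: t_def powr_diff field_simps)
    have "\<bar>a\<bar> powr p * (1 + p * t + (p * t)\<^sup>2)
        = \<bar>a\<bar> powr p + p * (\<bar>a\<bar> powr p * t) + p\<^sup>2 * (\<bar>a\<bar> powr p * t\<^sup>2)"
      by (simp add: algebra_simps power_mult_distrib)
    thus ?thesis unfolding 1 2 by simp
  qed
  also have "p\<^sup>2 * (\<bar>a\<bar> powr (p - 2) * b\<^sup>2)
      \<le> taylor_const p * (\<bar>a\<bar> powr (p - 2) * b\<^sup>2 + \<bar>b\<bar> powr p)"
    using taylor_const_ge[OF p] by (intro mult_mono) auto
  finally show ?thesis by (simp add: mult_left_mono)
next
  case False
  hence ab: "\<bar>a\<bar> \<le> p * \<bar>b\<bar>" using p by auto
  have "\<bar>a + b\<bar> \<le> (p + 1) * \<bar>b\<bar>" using ab by (simp add: algebra_simps)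
  hence "\<bar>a + b\<bar> powr p \<le> ((p + 1) * \<bar>b\<bar>) powr p" using p by (intro powr_mono2) auto
  hence 1: "\<bar>a + b\<bar> powr p \<le> (p + 1) powr p * \<bar>b\<bar> powr p" using p by (simp add: powr_mult)
  have "\<bar>a\<bar> powr (p - 1) \<le> (p * \<bar>b\<bar>) powr (p - 1)" using p ab by (intro powr_mono2) auto
  hence "p * \<bar>b\<bar> * \<bar>a\<bar> powr (p - 1) \<le> p * \<bar>b\<bar> * (p * \<bar>b\<bar>) powr (p - 1)"
    using p by (intro mult_left_mono) auto
  also have "\<dots> = (p * \<bar>b\<bar>) powr p" using p by (cases "b = 0") (auto simp: powr_diff)
  also have "\<dots> = p powr p * \<bar>b\<bar> powr p" using p by (simp add: powr_mult)
  finally have 2: "p * \<bar>b\<bar> * \<bar>a\<bar> powr (p - 1) \<le> p powr p * \<bar>b\<bar> powr p" .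
  have "- (p * (sgn a * \<bar>a\<bar> powr (p - 1)) * b) \<le> \<bar>p * (sgn a * \<bar>a\<bar> powr (p - 1)) * b\<bar>"
    by linarith
  also have "\<dots> \<le> p * \<bar>b\<bar> * \<bar>a\<bar> powr (p - 1)" using p by (auto simp: abs_mult abs_sgn_eq)
  also note 2
  finally have 3: "- (p * (sgn a * \<bar>a\<bar> powr (p - 1)) * b) \<le> p powr p * \<bar>b\<bar> powr p" .
  have 4: "0 \<le> taylor_const p * (\<bar>a\<bar> powr (p - 2) * b\<^sup>2)"
    using taylor_const_ge(2)[OF p] by (intro mult_nonneg_nonneg) auto
  have "\<bar>a + b\<bar> powr p \<le> p * (sgn a * \<bar>a\<bar> powr (p - 1)) * b + taylor_const p * \<bar>b\<bar> powr p"
    unfolding taylor_const_def using 1 3 by (simp add: distrib_right)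
  moreover have "0 \<le> \<bar>a\<bar> powr p" by simp
  ultimately show ?thesis using 4 unfolding distrib_left by linarith
qed

lemma powr_abs_add_le:
  fixes a b p :: real
  assumes "p \<ge> 0"
  shows "\<bar>a + b\<bar> powr p \<le> 2 powr p * (\<bar>a\<bar> powr p + \<bar>b\<bar> powr p)"
proof -
  have "\<bar>a + b\<bar> powr p \<le> (2 * max \<bar>a\<bar> \<bar>b\<bar>) powr p" using assms by (intro powr_mono2) auto
  also have "\<dots> = 2 powr p * (max \<bar>a\<bar> \<bar>b\<bar>) powr p" by (simp add: powr_mult)
  also have "(max \<bar>a\<bar> \<bar>b\<bar>) powr p \<le> \<bar>a\<bar> powr p + \<bar>b\<bar> powr p" by (auto simp: max_def)
  finally show ?thesis by simp
qed

text \<open>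
  A substitute for Jensen's and Hoelder's inequalities between moments: it is linear in
  \<open>u powr t\<close>, so expectations can be taken on both sides, and the threshold \<open>l\<close> remains free.
\<close>

lemma powr_le_lower_plus_higher:
  fixes u l s t :: real
  assumes "0 \<le> u" "0 < l" "0 \<le> s" "s \<le> t"
  shows "u powr s \<le> l powr s + u powr t * l powr (s - t)"
proof (cases "u \<le> l")
  case True
  then have "u powr s \<le> l powr s" using assms by (intro powr_mono2) auto
  thus ?thesis by (simp add: add_increasing2)
next
  case False
  have "u powr s = u powr t * u powr (s - t)" by (simp flip: powr_add)
  also have "\<dots> \<le> u powr t * l powr (s - t)"
    using False assms by (intro mult_left_mono powr_mono2') auto
  finally show ?thesis by (simp add: add_increasing)
qed

lemma powr_add_ge_tangent:
  fixes u v q :: real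
  assumes "u > 0" "v \<ge> 0" "q \<ge> 1"
  shows "(u + v) powr q \<ge> u powr q + q * u powr (q - 1) * v"
proof -
  have "q * u powr (q - 1) * (u + v - u) \<le> (u + v) powr q - u powr q"
    using assms
    by (intro convex_on_imp_above_tangent[OF powr_convex])
       (auto intro!: derivative_eq_intros simp: interior_open)
  thus ?thesis by simp
qed

lemma powr_add_superadditive:
  fixes u v q :: real
  assumes "u \<ge> 0" "v \<ge> 0" "q \<ge> 1"
  shows "u powr q + v powr q \<le> (u + v) powr q"
proof (cases "u + v = 0")
  case True
  then show ?thesis using assms by (simp add: add_nonneg_eq_0_iff)
next
  case False
  have *: "x powr q \<le> (u + v) powr (q - 1) * x" if "0 \<le> x" "x \<le> u + v" for x
  proof -
    have "x powr q = x powr (q - 1) * x" using that by (cases "x = 0") (auto simp: powr_diff)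
    also have "\<dots> \<le> (u + v) powr (q - 1) * x"
      using that assms by (intro mult_right_mono powr_mono2) auto
    finally show ?thesis .
  qed
  have "u powr q + v powr q \<le> (u + v) powr (q - 1) * (u + v)"
    using *[of u] *[of v] assms by (simp add: algebra_simps)
  also have "\<dots> = (u + v) powr q" using False assms by (simp add: powr_diff)
  finally show ?thesis .
qed

section \<open>Moments of sums of independent centred variables\<close>

context prob_space
begin

lemma lower_moment_le:
  fixes Z :: "'a \<Rightarrow> real"
  assumes [measurable]: "Z \<in> borel_measurable M"
    and int: "integrable M (\<lambda>\<omega>. \<bar>Z \<omega>\<bar> powr t)"
    and le: "expectation (\<lambda>\<omega>. \<bar>Z \<omega>\<bar> powr t) \<le> l powr t"
    and "l > 0" "0 \<le> s" "s \<le> t"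
  shows "integrable M (\<lambda>\<omega>. \<bar>Z \<omega>\<bar> powr s)"
    and "expectation (\<lambda>\<omega>. \<bar>Z \<omega>\<bar> powr s) \<le> 2 * l powr s"
proof -
  have pw: "\<bar>Z \<omega>\<bar> powr s \<le> l powr s + \<bar>Z \<omega>\<bar> powr t * l powr (s - t)" for \<omega>
    using assms by (intro powr_le_lower_plus_higher) auto
  have int': "integrable M (\<lambda>\<omega>. l powr s + \<bar>Z \<omega>\<bar> powr t * l powr (s - t))"
    using int by simp
  show *: "integrable M (\<lambda>\<omega>. \<bar>Z \<omega>\<bar> powr s)"
    by (rule Bochner_Integration.integrable_bound[OF int']) (auto intro!: AE_I2 order_trans[OF pw])
  have "expectation (\<lambda>\<omega>. \<bar>Z \<omega>\<bar> powr s)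
      \<le> expectation (\<lambda>\<omega>. l powr s + \<bar>Z \<omega>\<bar> powr t * l powr (s - t))"
    by (intro integral_mono * int' pw)
  also have "\<dots> = l powr s + expectation (\<lambda>\<omega>. \<bar>Z \<omega>\<bar> powr t) * l powr (s - t)"
    using int by (simp add: prob_space)
  also have "\<dots> \<le> l powr s + l powr t * l powr (s - t)"
    using le by (intro add_left_mono mult_right_mono) auto
  also have "\<dots> = 2 * l powr s" by (simp flip: powr_add)
  finally show "expectation (\<lambda>\<omega>. \<bar>Z \<omega>\<bar> powr s) \<le> 2 * l powr s" .
qed

text \<open>
  The bound of the previous lemma for exponents \<open>2\<close> and \<open>p\<close>, extended by continuity to \<open>x = 0\<close>.
\<close>

lemma second_moment_le:
  fixes Z :: "'a \<Rightarrow> real"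
  assumes [measurable]: "Z \<in> borel_measurable M"
    and int: "integrable M (\<lambda>\<omega>. \<bar>Z \<omega>\<bar> powr p)"
    and le: "expectation (\<lambda>\<omega>. \<bar>Z \<omega>\<bar> powr p) \<le> x powr p"
    and "x \<ge> 0" "p \<ge> 2"
  shows "integrable M (\<lambda>\<omega>. (Z \<omega>)\<^sup>2)" and "expectation (\<lambda>\<omega>. (Z \<omega>)\<^sup>2) \<le> 2 * x\<^sup>2"
proof -
  have *: "integrable M (\<lambda>\<omega>. (Z \<omega>)\<^sup>2) \<and> expectation (\<lambda>\<omega>. (Z \<omega>)\<^sup>2) \<le> 2 * l\<^sup>2"
    if "l > x" for l
  proof -
    have "expectation (\<lambda>\<omega>. \<bar>Z \<omega>\<bar> powr p) \<le> l powr p"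
      using that assms by (intro order_trans[OF le] powr_mono2) auto
    from lower_moment_le[OF assms(1) int this, of 2] that assms show ?thesis by simp
  qed
  show "integrable M (\<lambda>\<omega>. (Z \<omega>)\<^sup>2)" using *[of "x + 1"] by simp
  have "((\<lambda>l. 2 * l\<^sup>2) \<longlongrightarrow> 2 * x\<^sup>2) (at_right x)" by (intro tendsto_intros)
  moreover have "\<forall>\<^sub>F l in at_right x. expectation (\<lambda>\<omega>. (Z \<omega>)\<^sup>2) \<le> 2 * l\<^sup>2"
    using * eventually_at_right_less by (rule_tac eventually_mono[OF eventually_at_right_less]) auto
  ultimately show "expectation (\<lambda>\<omega>. (Z \<omega>)\<^sup>2) \<le> 2 * x\<^sup>2"
    by (intro tendsto_lowerbound) auto
qed

lemma moment_add_le: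
  fixes A B :: "'a \<Rightarrow> real"
  assumes p: "p \<ge> 0" and [measurable]: "A \<in> borel_measurable M" "B \<in> borel_measurable M"
    and "integrable M (\<lambda>\<omega>. \<bar>A \<omega>\<bar> powr p)" "integrable M (\<lambda>\<omega>. \<bar>B \<omega>\<bar> powr p)"
    and "expectation (\<lambda>\<omega>. \<bar>A \<omega>\<bar> powr p) \<le> a" "expectation (\<lambda>\<omega>. \<bar>B \<omega>\<bar> powr p) \<le> b"
  shows "integrable M (\<lambda>\<omega>. \<bar>A \<omega> + B \<omega>\<bar> powr p)"
    and "expectation (\<lambda>\<omega>. \<bar>A \<omega> + B \<omega>\<bar> powr p) \<le> 2 powr p * (a + b)"
proof -
  have i: "integrable M (\<lambda>\<omega>. 2 powr p * (\<bar>A \<omega>\<bar> powr p + \<bar>B \<omega>\<bar> powr p))" using assms by simp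
  have pw: "\<bar>A \<omega> + B \<omega>\<bar> powr p \<le> 2 powr p * (\<bar>A \<omega>\<bar> powr p + \<bar>B \<omega>\<bar> powr p)" for \<omega>
    using p by (intro powr_abs_add_le) auto
  show int: "integrable M (\<lambda>\<omega>. \<bar>A \<omega> + B \<omega>\<bar> powr p)"
    by (rule Bochner_Integration.integrable_bound[OF i]) (use pw in \<open>auto intro!: AE_I2\<close>)
  have "expectation (\<lambda>\<omega>. \<bar>A \<omega> + B \<omega>\<bar> powr p) \<le> expectation (\<lambda>\<omega>. 2 powr p * (\<bar>A \<omega>\<bar> powr p + \<bar>B \<omega>\<bar> powr p))"
    by (intro integral_mono int i pw)
  also have "\<dots> = 2 powr p * (expectation (\<lambda>\<omega>. \<bar>A \<omega>\<bar> powr p) + expectation (\<lambda>\<omega>. \<bar>B \<omega>\<bar> powr p))"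
    using assms by simp
  also have "\<dots> \<le> 2 powr p * (a + b)" using assms by (intro mult_left_mono add_mono) auto
  finally show "expectation (\<lambda>\<omega>. \<bar>A \<omega> + B \<omega>\<bar> powr p) \<le> 2 powr p * (a + b)" .
qed

text \<open>
  Adding one independent centred summand. In the Taylor bound the linear term has expectation \<open>0\<close>
  and the quadratic term factorizes, so only \<open>E \<bar>S\<bar> powr (p - 2) * E X\<^sup>2\<close> and \<open>E \<bar>X\<bar> powr p\<close> are left.
  With \<open>u\<close> for the squared \<open>L\<^sup>p\<close> bound on \<open>S\<close> and \<open>v\<close> for its increment, these two terms are
  absorbed by \<open>(u + v) powr (p / 2)\<close>: half of the increment is estimated from below by the tangent at
  \<open>u\<close>, the other half by superadditivity. The factor \<open>8\<close> is what makes the two halves large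
  enough.
\<close>

lemma moment_add_indep_centered_le:
  fixes S X :: "'a \<Rightarrow> real"
  assumes p: "p \<ge> 2" and ind: "indep_var borel X borel S"
    and intS: "integrable M (\<lambda>\<omega>. \<bar>S \<omega>\<bar> powr p)"
    and intX: "integrable M (\<lambda>\<omega>. \<bar>X \<omega>\<bar> powr p)"
    and centered: "expectation X = 0"
    and leS: "expectation (\<lambda>\<omega>. \<bar>S \<omega>\<bar> powr p) \<le> (8 * taylor_const p * B) powr (p / 2)"
    and leX: "expectation (\<lambda>\<omega>. \<bar>X \<omega>\<bar> powr p) \<le> x powr p"
    and B: "B > 0" and x: "x \<ge> 0"
  shows "integrable M (\<lambda>\<omega>. \<bar>S \<omega> + X \<omega>\<bar> powr p)"
    and "expectation (\<lambda>\<omega>. \<bar>S \<omega> + X \<omega>\<bar> powr p) \<le> (8 * taylor_const p * (B + x\<^sup>2)) powr (p / 2)"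
proof -
  define C where "C = taylor_const p"
  have C: "C \<ge> 1" using taylor_const_ge[OF p] by (simp add: C_def)
  have X[measurable]: "X \<in> borel_measurable M" and S[measurable]: "S \<in> borel_measurable M"
    using indep_var_rv1[OF ind] indep_var_rv2[OF ind] by auto
  define u where "u = 8 * C * B"
  define v where "v = 8 * C * x\<^sup>2"
  have u: "u > 0" and v: "v \<ge> 0" using B C by (auto simp: u_def v_def)
  define l where "l = sqrt u"
  have l: "l > 0" using u by (simp add: l_def)
  have lp: "l powr s = u powr (s / 2)" for s
    using u by (simp add: l_def powr_powr flip: powr_half_sqrt)
  have leS': "expectation (\<lambda>\<omega>. \<bar>S \<omega>\<bar> powr p) \<le> l powr p"
    using leS by (simp add: lp u_def C_def)
  note momS = lower_moment_le[OF S intS leS' l]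
  note momX = second_moment_le[OF X intX leX x p]
  show int: "integrable M (\<lambda>\<omega>. \<bar>S \<omega> + X \<omega>\<bar> powr p)"
    using p by (intro moment_add_le(1)[OF _ S X intS intX order_refl order_refl]) simp
  have intX1: "integrable M X"
    by (rule square_integrable_imp_integrable) (use momX in auto)
  have intg: "integrable M (\<lambda>\<omega>. sgn (S \<omega>) * \<bar>S \<omega>\<bar> powr (p - 1))"
    by (rule Bochner_Integration.integrable_bound[OF momS(1)[of "p - 1"]])
       (use p in \<open>auto simp: abs_mult abs_sgn_eq\<close>)
  have ind1: "indep_var borel X borel (\<lambda>\<omega>. sgn (S \<omega>) * \<bar>S \<omega>\<bar> powr (p - 1))"
    using indep_var_compose[OF ind, of id borel "\<lambda>s. sgn s * \<bar>s\<bar> powr (p - 1)" borel]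
    by (simp add: comp_def id_def)
  have ind2: "indep_var borel (\<lambda>\<omega>. (X \<omega>)\<^sup>2) borel (\<lambda>\<omega>. \<bar>S \<omega>\<bar> powr (p - 2))"
    using indep_var_compose[OF ind, of "\<lambda>x. x\<^sup>2" borel "\<lambda>s. \<bar>s\<bar> powr (p - 2)" borel]
    by (simp add: comp_def)
  have i1: "integrable M (\<lambda>\<omega>. X \<omega> * (sgn (S \<omega>) * \<bar>S \<omega>\<bar> powr (p - 1)))"
    by (rule indep_var_integrable[OF ind1 intX1 intg])
  have e1: "expectation (\<lambda>\<omega>. X \<omega> * (sgn (S \<omega>) * \<bar>S \<omega>\<bar> powr (p - 1))) = 0"
    using indep_var_lebesgue_integral[OF ind1 intX1 intg] centered by simp
  have intS2: "integrable M (\<lambda>\<omega>. \<bar>S \<omega>\<bar> powr (p - 2))" using momS(1)[of "p - 2"] p by simp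
  have i2: "integrable M (\<lambda>\<omega>. (X \<omega>)\<^sup>2 * \<bar>S \<omega>\<bar> powr (p - 2))"
    by (rule indep_var_integrable[OF ind2 momX(1) intS2])
  have e2: "expectation (\<lambda>\<omega>. (X \<omega>)\<^sup>2 * \<bar>S \<omega>\<bar> powr (p - 2)) \<le> 2 * x\<^sup>2 * (2 * u powr (p / 2 - 1))"
  proof -
    have "expectation (\<lambda>\<omega>. (X \<omega>)\<^sup>2 * \<bar>S \<omega>\<bar> powr (p - 2))
        = expectation (\<lambda>\<omega>. (X \<omega>)\<^sup>2) * expectation (\<lambda>\<omega>. \<bar>S \<omega>\<bar> powr (p - 2))"
      by (rule indep_var_lebesgue_integral[OF ind2 momX(1) intS2])
    also have "\<dots> \<le> 2 * x\<^sup>2 * (2 * l powr (p - 2))"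
      using p by (intro mult_mono momX momS) (auto intro!: integral_nonneg_AE)
    finally show ?thesis by (simp add: lp diff_divide_distrib)
  qed
  have i3: "integrable M (\<lambda>\<omega>. \<bar>S \<omega>\<bar> powr p + p * (X \<omega> * (sgn (S \<omega>) * \<bar>S \<omega>\<bar> powr (p - 1)))
      + C * ((X \<omega>)\<^sup>2 * \<bar>S \<omega>\<bar> powr (p - 2) + \<bar>X \<omega>\<bar> powr p))"
    using i1 i2 intS intX by simp
  have "expectation (\<lambda>\<omega>. \<bar>S \<omega> + X \<omega>\<bar> powr p)
    \<le> expectation (\<lambda>\<omega>. \<bar>S \<omega>\<bar> powr p + p * (X \<omega> * (sgn (S \<omega>) * \<bar>S \<omega>\<bar> powr (p - 1)))
      + C * ((X \<omega>)\<^sup>2 * \<bar>S \<omega>\<bar> powr (p - 2) + \<bar>X \<omega>\<bar> powr p))"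
  proof (intro integral_mono int i3)
    fix \<omega>
    show "\<bar>S \<omega> + X \<omega>\<bar> powr p \<le> \<bar>S \<omega>\<bar> powr p + p * (X \<omega> * (sgn (S \<omega>) * \<bar>S \<omega>\<bar> powr (p - 1)))
      + C * ((X \<omega>)\<^sup>2 * \<bar>S \<omega>\<bar> powr (p - 2) + \<bar>X \<omega>\<bar> powr p)"
      using powr_abs_add_le_taylor[OF p, of "S \<omega>" "X \<omega>"] by (simp add: C_def mult_ac)
  qed
  also have "\<dots> = expectation (\<lambda>\<omega>. \<bar>S \<omega>\<bar> powr p)
      + C * (expectation (\<lambda>\<omega>. (X \<omega>)\<^sup>2 * \<bar>S \<omega>\<bar> powr (p - 2)) + expectation (\<lambda>\<omega>. \<bar>X \<omega>\<bar> powr p))"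
    using i1 i2 intS intX e1 by simp
  also have "\<dots> \<le> u powr (p / 2) + C * (2 * x\<^sup>2 * (2 * u powr (p / 2 - 1)) + x powr p)"
    using C leS' e2 leX by (intro add_mono mult_left_mono) (auto simp: lp)
  also have "\<dots> \<le> (u + v) powr (p / 2)"
  proof -
    have "u powr (p / 2) + p / 2 * u powr (p / 2 - 1) * v \<le> (u + v) powr (p / 2)"
      using p by (intro powr_add_ge_tangent u v) auto
    moreover have "1 * (u powr (p / 2 - 1) * v) \<le> p / 2 * (u powr (p / 2 - 1) * v)"
      using p v by (intro mult_right_mono) auto
    ultimately have 1: "u powr (p / 2) + u powr (p / 2 - 1) * v \<le> (u + v) powr (p / 2)"
      by (simp add: mult_ac)
    have 2: "u powr (p / 2) + v powr (p / 2) \<le> (u + v) powr (p / 2)"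
      using p u v by (intro powr_add_superadditive) auto
    have 3: "u powr (p / 2 - 1) * v = 2 * (C * (2 * x\<^sup>2 * (2 * u powr (p / 2 - 1))))"
      by (simp add: v_def)
    have "2 * C * x powr p \<le> (8 * C) powr (p / 2) * x powr p"
    proof (rule mult_right_mono)
      have "2 * C \<le> (8 * C) powr 1" using C by simp
      also have "\<dots> \<le> (8 * C) powr (p / 2)" using p C by (intro powr_mono) auto
      finally show "2 * C \<le> (8 * C) powr (p / 2)" .
    qed simp
    also have "\<dots> = v powr (p / 2)"
    proof -
      have "(x\<^sup>2) powr (p / 2) = x powr p"
        using x by (cases "x = 0") (auto simp: powr_powr simp flip: powr_numeral)
      thus ?thesis using C by (simp add: v_def powr_mult)
    qed
    finally have 4: "2 * (C * x powr p) \<le> v powr (p / 2)" by simp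
    show ?thesis using 1 2 3 4 by (simp only: distrib_left)
  qed
  finally show "expectation (\<lambda>\<omega>. \<bar>S \<omega> + X \<omega>\<bar> powr p) \<le> (8 * taylor_const p * (B + x\<^sup>2)) powr (p / 2)"
    by (simp add: u_def v_def C_def distrib_left)
qed

text \<open>
  \<open>L\<^sup>p\<close> has type 2 for \<open>p \<ge> 2\<close>: squared \<open>L\<^sup>p\<close> norms of independent centred variables add up, up to a
  constant, as variances do. This is weaker than the Rosenthal inequality but sufficient when the
  \<open>L\<^sup>p\<close> norm of each summand is of the order of its \<open>L\<^sup>2\<close> bound.
\<close>

proposition moment_sum_indep_centered_le:
  fixes X :: "'i \<Rightarrow> 'a \<Rightarrow> real"
  assumes p: "p \<ge> 2" and "finite I" and "indep_vars (\<lambda>_. borel) X I"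
    and "\<And>i. i \<in> I \<Longrightarrow> integrable M (\<lambda>\<omega>. \<bar>X i \<omega>\<bar> powr p)"
    and "\<And>i. i \<in> I \<Longrightarrow> expectation (X i) = 0"
    and "\<And>i. i \<in> I \<Longrightarrow> expectation (\<lambda>\<omega>. \<bar>X i \<omega>\<bar> powr p) \<le> x i powr p"
    and "\<And>i. i \<in> I \<Longrightarrow> x i \<ge> 0"
  shows "integrable M (\<lambda>\<omega>. \<bar>\<Sum>i\<in>I. X i \<omega>\<bar> powr p)"
    and "expectation (\<lambda>\<omega>. \<bar>\<Sum>i\<in>I. X i \<omega>\<bar> powr p) \<le> (8 * taylor_const p * (\<Sum>i\<in>I. (x i)\<^sup>2)) powr (p / 2)"
proof -
  define C where "C = 8 * taylor_const p"
  have C: "C \<ge> 0" using taylor_const_ge[OF p] by (simp add: C_def)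
  \<comment> \<open>The shift \<open>b\<close> keeps the bound on the partial sums strictly positive during the induction; it
     tends to \<open>0\<close> at the end.\<close>
  have *: "integrable M (\<lambda>\<omega>. \<bar>\<Sum>i\<in>I. X i \<omega>\<bar> powr p) \<and>
      expectation (\<lambda>\<omega>. \<bar>\<Sum>i\<in>I. X i \<omega>\<bar> powr p) \<le> (C * (b + (\<Sum>i\<in>I. (x i)\<^sup>2))) powr (p / 2)"
    if b: "b > 0" for b
    using assms(2-)
  proof (induction I rule: finite_induct)
    case empty
    thus ?case by simp
  next
    case (insert i I)
    have ind: "indep_var borel (X i) borel (\<lambda>\<omega>. \<Sum>i\<in>I. X i \<omega>)"
      by (rule indep_vars_sum[OF insert.hyps insert.prems(1)])
    have "integrable M (\<lambda>\<omega>. \<bar>\<Sum>i\<in>I. X i \<omega>\<bar> powr p) \<and>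
      expectation (\<lambda>\<omega>. \<bar>\<Sum>i\<in>I. X i \<omega>\<bar> powr p) \<le> (C * (b + (\<Sum>i\<in>I. (x i)\<^sup>2))) powr (p / 2)"
      by (rule insert.IH) (use insert.prems indep_vars_subset[OF insert.prems(1) subset_insertI] in auto)
    moreover have "b + (\<Sum>i\<in>I. (x i)\<^sup>2) > 0" using b by (intro add_pos_nonneg sum_nonneg) auto
    ultimately show ?case
      using moment_add_indep_centered_le[OF p ind, of "b + (\<Sum>i\<in>I. (x i)\<^sup>2)" "x i"]
        insert.prems insert.hyps by (simp add: C_def add_ac)
  qed
  show "integrable M (\<lambda>\<omega>. \<bar>\<Sum>i\<in>I. X i \<omega>\<bar> powr p)" using *[of 1] by simp
  have "((\<lambda>b. (C * (b + (\<Sum>i\<in>I. (x i)\<^sup>2))) powr (p / 2))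
      \<longlongrightarrow> (C * (0 + (\<Sum>i\<in>I. (x i)\<^sup>2))) powr (p / 2)) (at_right 0)"
    using p C by (intro tendsto_powr' tendsto_intros)
      (auto simp: eventually_at_filter intro!: always_eventually mult_nonneg_nonneg add_nonneg_nonneg sum_nonneg)
  moreover have "\<forall>\<^sub>F b in at_right 0. expectation (\<lambda>\<omega>. \<bar>\<Sum>i\<in>I. X i \<omega>\<bar> powr p)
      \<le> (C * (b + (\<Sum>i\<in>I. (x i)\<^sup>2))) powr (p / 2)"
    using * by (rule_tac eventually_mono[OF eventually_at_right_less]) auto
  ultimately have "expectation (\<lambda>\<omega>. \<bar>\<Sum>i\<in>I. X i \<omega>\<bar> powr p) \<le> (C * (0 + (\<Sum>i\<in>I. (x i)\<^sup>2))) powr (p / 2)"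
    by (intro tendsto_lowerbound) auto
  thus "expectation (\<lambda>\<omega>. \<bar>\<Sum>i\<in>I. X i \<omega>\<bar> powr p) \<le> (8 * taylor_const p * (\<Sum>i\<in>I. (x i)\<^sup>2)) powr (p / 2)"
    by (simp add: C_def)
qed

text \<open>
  Centring costs only a constant factor in the \<open>L\<^sup>p\<close> bound: \<open>Z - E Z\<close> is bounded through \<open>\<bar>E Z\<bar> \<le> 2 * l\<close>, which gives
  \<open>2 powr p + 4 powr p \<le> 8 powr p\<close> times \<open>l powr p\<close>.
\<close>

lemma moment_centered_le:
  fixes Z :: "'a \<Rightarrow> real"
  assumes p: "p \<ge> 1" and Z[measurable]: "Z \<in> borel_measurable M"
    and int: "integrable M (\<lambda>\<omega>. \<bar>Z \<omega>\<bar> powr p)"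
    and le: "expectation (\<lambda>\<omega>. \<bar>Z \<omega>\<bar> powr p) \<le> l powr p" and l: "l > 0"
  shows "integrable M Z"
    and "\<bar>expectation Z\<bar> \<le> 2 * l"
    and "integrable M (\<lambda>\<omega>. \<bar>Z \<omega> - expectation Z\<bar> powr p)"
    and "expectation (\<lambda>\<omega>. \<bar>Z \<omega> - expectation Z\<bar> powr p) \<le> (8 * l) powr p"
proof -
  note mom = lower_moment_le[OF Z int le l, of 1]
  have "(\<lambda>\<omega>. \<bar>Z \<omega>\<bar> powr 1) = (\<lambda>\<omega>. \<bar>Z \<omega>\<bar>)" by simp
  with mom p l have 1: "integrable M (\<lambda>\<omega>. \<bar>Z \<omega>\<bar>)" and 2: "expectation (\<lambda>\<omega>. \<bar>Z \<omega>\<bar>) \<le> 2 * l"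
    by (simp_all del: powr_one_eq_one)
  show "integrable M Z" using 1 by (subst (asm) integrable_abs_iff) auto
  show m: "\<bar>expectation Z\<bar> \<le> 2 * l" by (rule order_trans[OF integral_abs_bound 2])
  have bd: "\<bar>Z \<omega> - expectation Z\<bar> powr p \<le> 2 powr p * (\<bar>Z \<omega>\<bar> powr p + (2 * l) powr p)" for \<omega>
  proof -
    have "\<bar>Z \<omega> + (- expectation Z)\<bar> powr p \<le> 2 powr p * (\<bar>Z \<omega>\<bar> powr p + \<bar>- expectation Z\<bar> powr p)"
      using p by (intro powr_abs_add_le) auto
    also have "\<dots> \<le> 2 powr p * (\<bar>Z \<omega>\<bar> powr p + (2 * l) powr p)"
      using p m by (intro mult_left_mono add_left_mono powr_mono2) auto
    finally show ?thesis by simp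
  qed
  have i: "integrable M (\<lambda>\<omega>. 2 powr p * (\<bar>Z \<omega>\<bar> powr p + (2 * l) powr p))" using int by simp
  show i2: "integrable M (\<lambda>\<omega>. \<bar>Z \<omega> - expectation Z\<bar> powr p)"
    by (rule Bochner_Integration.integrable_bound[OF i]) (use bd in \<open>auto intro!: AE_I2\<close>)
  have "expectation (\<lambda>\<omega>. \<bar>Z \<omega> - expectation Z\<bar> powr p)
      \<le> expectation (\<lambda>\<omega>. 2 powr p * (\<bar>Z \<omega>\<bar> powr p + (2 * l) powr p))"
    by (intro integral_mono i2 i bd)
  also have "\<dots> = 2 powr p * (expectation (\<lambda>\<omega>. \<bar>Z \<omega>\<bar> powr p) + (2 * l) powr p)"
    using int by (simp add: prob_space)
  also have "\<dots> \<le> 2 powr p * (l powr p + (2 * l) powr p)"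
    using le by (intro mult_left_mono add_right_mono) auto
  also have "\<dots> = (2 powr p + 4 powr p) * l powr p"
  proof -
    have "(4 :: real) powr p = 2 powr p * 2 powr p" by (simp flip: powr_mult)
    thus ?thesis using l by (simp add: powr_mult algebra_simps)
  qed
  also have "\<dots> \<le> 8 powr p * l powr p"
  proof (rule mult_right_mono)
    have "2 powr p + 4 powr p \<le> 2 powr 1 * 4 powr p" using p by (auto intro!: powr_mono2)
    also have "\<dots> \<le> 2 powr p * 4 powr p" using p by (intro mult_right_mono powr_mono) auto
    also have "\<dots> = 8 powr p" by (simp flip: powr_mult)
    finally show "2 powr p + 4 powr p \<le> 8 powr p" .
  qed simp
  also have "\<dots> = (8 * l) powr p" using l by (simp add: powr_mult)
  finally show "expectation (\<lambda>\<omega>. \<bar>Z \<omega> - expectation Z\<bar> powr p) \<le> (8 * l) powr p" .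
qed

text \<open>
  The expectation of \<open>\<Sum>k. \<bar>X k\<bar> powr p\<close> is finite by monotone convergence, hence the series converges
  almost surely and its terms tend to \<open>0\<close>. Starting at \<open>n\<close> allows finitely many variables without any
  control.
\<close>

lemma AE_tendsto_zero_of_summable_moments:
  fixes X :: "nat \<Rightarrow> 'a \<Rightarrow> real"
  assumes p: "p > 0"
    and X: "\<And>k. k \<ge> n \<Longrightarrow> X k \<in> borel_measurable M"
    and int: "\<And>k. k \<ge> n \<Longrightarrow> integrable M (\<lambda>\<omega>. \<bar>X k \<omega>\<bar> powr p)"
    and le: "\<And>k. k \<ge> n \<Longrightarrow> expectation (\<lambda>\<omega>. \<bar>X k \<omega>\<bar> powr p) \<le> a k"
    and "summable a"
  shows "AE \<omega> in M. (\<lambda>k. X k \<omega>) \<longlonglongrightarrow> 0"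
proof -
  define f where "f k \<omega> = ennreal (\<bar>X (k + n) \<omega>\<bar> powr p)" for k \<omega>
  have [measurable]: "X (k + n) \<in> borel_measurable M" for k using X by simp
  have a0: "0 \<le> a (k + n)" for k
    by (rule order_trans[OF _ le]) (auto intro!: integral_nonneg_AE)
  have "(\<integral>\<^sup>+\<omega>. (\<Sum>k. f k \<omega>) \<partial>M) = (\<Sum>k. \<integral>\<^sup>+\<omega>. f k \<omega> \<partial>M)"
    unfolding f_def by (intro nn_integral_suminf) measurable
  also have "\<dots> \<le> (\<Sum>k. ennreal (a (k + n)))"
    by (intro suminf_le) (auto simp: f_def nn_integral_eq_integral int intro!: ennreal_leI le)
  also have "\<dots> < \<infinity>"
    using assms a0 by (subst suminf_ennreal2) (auto simp: summable_iff_shift)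
  finally have "AE \<omega> in M. (\<Sum>k. f k \<omega>) \<noteq> \<infinity>"
    by (intro nn_integral_PInf_AE) (auto simp: f_def)
  thus ?thesis
  proof (rule AE_mp, intro AE_I2 impI)
    fix \<omega> assume "(\<Sum>k. f k \<omega>) \<noteq> \<infinity>"
    hence "summable (\<lambda>k. \<bar>X (k + n) \<omega>\<bar> powr p)"
      unfolding f_def by (intro summable_suminf_not_top) auto
    hence "(\<lambda>k. \<bar>X (k + n) \<omega>\<bar> powr p) \<longlonglongrightarrow> 0" by (rule summable_LIMSEQ_zero)
    hence "(\<lambda>k. (\<bar>X (k + n) \<omega>\<bar> powr p) powr (1 / p)) \<longlonglongrightarrow> 0 powr (1 / p)"
      using p by (intro tendsto_powr') (auto intro: tendsto_const)
    hence "(\<lambda>k. X (k + n) \<omega>) \<longlonglongrightarrow> 0" using p by (simp add: powr_powr tendsto_rabs_zero_iff)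
    thus "(\<lambda>k. X k \<omega>) \<longlonglongrightarrow> 0" by (rule LIMSEQ_offset)
  qed
qed

end

section \<open>Lagrange weights at geometric nodes\<close>

definition lagrange_poly :: "('i \<Rightarrow> real) \<Rightarrow> 'i set \<Rightarrow> 'i \<Rightarrow> real poly" where
  "lagrange_poly x A r = (\<Prod>s\<in>A - {r}. [:- x s / (x r - x s), 1 / (x r - x s):])"

lemma poly_lagrange_poly_node:
  assumes "finite A" "inj_on x A" "r \<in> A" "t \<in> A"
  shows "poly (lagrange_poly x A r) (x t) = (if t = r then 1 else 0)"
proof (cases "t = r")
  case True
  have "(- x s / (x r - x s) + x r * (1 / (x r - x s))) = 1" if "s \<in> A - {r}" for s
  proof -
    have "x r - x s \<noteq> 0" using assms that by (auto simp: inj_on_def)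
    thus ?thesis by (simp add: diff_divide_distrib[symmetric])
  qed
  thus ?thesis using True by (simp add: lagrange_poly_def poly_prod)
next
  case False
  thus ?thesis using assms by (auto simp: lagrange_poly_def poly_prod intro!: bexI[of _ t])
qed

lemma degree_lagrange_poly:
  assumes "finite A" "r \<in> A"
  shows "degree (lagrange_poly x A r) < card A"
proof -
  have "degree (lagrange_poly x A r) \<le> (\<Sum>s\<in>A - {r}. 1)"
    unfolding lagrange_poly_def
    by (intro order_trans[OF degree_prod_sum_le] sum_mono) (use assms in auto)
  also have "\<dots> < card A" using card_Diff1_less[OF assms] by simp
  finally show ?thesis .
qed

text \<open>
  The Lagrange interpolation of the monomial \<open>X\<^sup>i\<close> reproduces it for \<open>i < card A\<close>; evaluating at \<open>0\<close> shows
  that the values at \<open>0\<close> of the Lagrange basis polynomials solve the Vandermonde system of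
  Richardson--Romberg extrapolation.
\<close>

lemma lagrange_weights_solve_vandermonde:
  fixes x :: "'i \<Rightarrow> real"
  assumes A: "finite A" "inj_on x A" and i: "i < card A"
  shows "(\<Sum>r\<in>A. (\<Prod>s\<in>A - {r}. x s / (x s - x r)) * x r ^ i) = 0 ^ i"
proof -
  define q where "q = (\<Sum>r\<in>A. smult (x r ^ i) (lagrange_poly x A r))"
  have "q = monom 1 i"
  proof (rule poly_eqI_degree[where A = "x ` A"])
    fix y assume "y \<in> x ` A"
    then obtain t where t: "t \<in> A" "y = x t" by auto
    have "poly q y = (\<Sum>r\<in>A. if r = t then x t ^ i else 0)"
      unfolding q_def poly_sum using A t by (intro sum.cong) (auto simp: poly_lagrange_poly_node)
    thus "poly q y = poly (monom 1 i) y" using A t by (simp add: poly_monom)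
  next
    have "degree q \<le> card A - 1" unfolding q_def
    proof (intro degree_sum_le A)
      fix r assume "r \<in> A"
      with degree_lagrange_poly[OF A(1) this, of x]
      show "degree (smult (x r ^ i) (lagrange_poly x A r)) \<le> card A - 1"
        by (intro order_trans[OF degree_smult_le]) simp
    qed
    thus "degree q < card (x ` A)" using A i by (simp add: card_image)
    show "degree (monom (1::real) i) < card (x ` A)" using A i by (simp add: card_image degree_monom_eq)
  qed
  hence "poly q 0 = 0 ^ i" by (simp add: poly_monom)
  moreover have "poly q 0 = (\<Sum>r\<in>A. (\<Prod>s\<in>A - {r}. x s / (x s - x r)) * x r ^ i)"
  proof -
    have "- x s / (x r - x s) = x s / (x s - x r)" for s r
      by (metis minus_diff_eq minus_divide_divide minus_minus)
    thus ?thesis by (simp add: q_def poly_sum lagrange_poly_def poly_prod mult_ac)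
  qed
  ultimately show ?thesis by simp
qed

text \<open>
  By linearity \<open>\<Sum>r\<in>A. u r * q (x r) = 0\<close> for every polynomial \<open>q\<close> of degree below \<open>card A\<close>; the Lagrange
  basis polynomial of \<open>t\<close> isolates \<open>u t\<close>.
\<close>

lemma vandermonde_kernel_trivial:
  fixes x u :: "'i \<Rightarrow> real"
  assumes A: "finite A" "inj_on x A"
    and 0: "\<And>i. i < card A \<Longrightarrow> (\<Sum>r\<in>A. u r * x r ^ i) = 0" and t: "t \<in> A"
  shows "u t = 0"
proof -
  define q where "q = lagrange_poly x A t"
  have "(\<Sum>r\<in>A. u r * poly q (x r)) = (\<Sum>r\<in>A. \<Sum>i\<le>degree q. coeff q i * (u r * x r ^ i))"
    by (simp add: poly_altdef sum_distrib_left mult_ac)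
  also have "\<dots> = (\<Sum>i\<le>degree q. coeff q i * (\<Sum>r\<in>A. u r * x r ^ i))"
    by (subst sum.swap) (simp add: sum_distrib_left)
  also have "\<dots> = 0"
    using degree_lagrange_poly[OF A(1) t, of x] by (intro sum.neutral) (auto simp: 0 q_def)
  finally have "0 = (\<Sum>r\<in>A. u r * poly q (x r))" by simp
  also have "\<dots> = (\<Sum>r\<in>A. if r = t then u t else 0)"
    unfolding q_def using A t by (intro sum.cong) (auto simp: poly_lagrange_poly_node)
  finally show ?thesis using A t by simp
qed

text \<open>
  With \<open>g = M powr (- \<alpha>)\<close> the nodes \<open>refiner M r powr (- \<alpha>)\<close> are the powers \<open>g ^ (r - 1)\<close>. Existence and
  uniqueness for the Vandermonde system identify the definite description with the Lagrange
  weights.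
\<close>

lemma ml2r_weight_eq:
  fixes \<alpha> :: real
  assumes \<alpha>: "\<alpha> > 0" and M: "M \<ge> 2" and R: "R \<ge> 1"
  defines "g \<equiv> real M powr (- \<alpha>)"
  shows "r \<in> {1..R} \<Longrightarrow>
           ml2r_weight \<alpha> M R r = (\<Prod>s\<in>{1..R} - {r}. g ^ (s - 1) / (g ^ (s - 1) - g ^ (r - 1)))"
    and "(\<Sum>r=1..R. ml2r_weight \<alpha> M R r) = 1"
proof -
  have g: "0 < g" "g < 1" using \<alpha> M by (auto simp: g_def powr_less_one)
  define x where "x = (\<lambda>s. g ^ (s - 1))"
  define w where "w = (\<lambda>r\<in>{1..R}. \<Prod>s\<in>{1..R} - {r}. x s / (x s - x r))"
  have x: "refiner M r powr (- \<alpha> * real i) = x r ^ i" for r i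
  proof -
    have "refiner M r powr (- \<alpha> * real i) = (real M powr (- \<alpha>)) powr real ((r - 1) * i)"
      using M by (simp add: refiner_def powr_powr mult_ac flip: powr_realpow)
    also have "\<dots> = x r ^ i"
      using g unfolding g_def[symmetric] by (subst powr_realpow) (auto simp: x_def power_mult)
    finally show ?thesis .
  qed
  have inj: "inj_on x {1..R}"
    using g by (auto simp: inj_on_def x_def power_inject_exp' eq_diff_iff)
  have sol: "(\<Sum>r=1..R. w r * x r ^ i) = 0 ^ i" if "i < R" for i
    using lagrange_weights_solve_vandermonde[OF _ inj, of i] that by (simp add: w_def)
  let ?P = "\<lambda>w. w \<in> extensional {1..R} \<and> (\<Sum>r=1..R. w r) = 1 \<and>
        (\<forall>i\<in>{1..R - 1}. (\<Sum>r=1..R. w r * refiner M r powr (- \<alpha> * real i)) = 0)"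
  have P: "?P w"
    using sol[of 0] sol R unfolding x by (auto simp: w_def power_0_left)
  have "ml2r_weight \<alpha> M R = w"
    unfolding ml2r_weight_def
  proof (rule the_equality)
    fix u assume u: "?P u"
    show "u = w"
    proof (rule extensionalityI[of _ "{1..R}"])
      fix t assume t: "t \<in> {1..R}"
      have "u t - w t = 0"
      proof (rule vandermonde_kernel_trivial[OF _ inj _ t])
        fix i assume "i < card {1..R}"
        hence "i = 0 \<or> i \<in> {1..R - 1}" by auto
        thus "(\<Sum>r=1..R. (u r - w r) * x r ^ i) = 0"
          using u P unfolding x by (auto simp: left_diff_distrib sum_subtractf)
      qed simp
      thus "u t = w t" by simp
    qed (use u P in auto)
  qed (rule P)
  thus "r \<in> {1..R} \<Longrightarrow> ml2r_weight \<alpha> M R r = (\<Prod>s\<in>{1..R} - {r}. g ^ (s - 1) / (g ^ (s - 1) - g ^ (r - 1)))"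
    and "(\<Sum>r=1..R. ml2r_weight \<alpha> M R r) = 1"
    using P by (auto simp: w_def x_def)
qed

lemma geometric_node_factor_le:
  fixes g :: real
  assumes g: "0 < g" "g < 1" and "s \<noteq> r" "s \<ge> 1" "r \<ge> 1"
  shows "\<bar>g ^ (s - 1) / (g ^ (s - 1) - g ^ (r - 1))\<bar>
           \<le> (if r < s then g else 1) * exp (g ^ (if r < s then s - r else r - s) / (1 - g))"
proof -
  have geo: "1 / (1 - g ^ d) \<le> exp (g ^ d / (1 - g))" if "d \<ge> 1" for d
  proof -
    have gd: "g ^ d \<le> g" "g ^ d > 0" using g that power_decreasing[of 1 d g] by auto
    have "1 / (1 - g ^ d) = 1 + g ^ d / (1 - g ^ d)" using gd g by (simp add: field_simps)
    also have "g ^ d / (1 - g ^ d) \<le> g ^ d / (1 - g)" using gd g by (intro divide_left_mono) auto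
    also have "1 + g ^ d / (1 - g) \<le> exp (g ^ d / (1 - g))" by (rule exp_ge_add_one_self)
    finally show ?thesis by simp
  qed
  show ?thesis
  proof (cases "r < s")
    case True
    define d where "d = s - r"
    have d: "d \<ge> 1" "s - 1 = (r - 1) + d" using True assms by (auto simp: d_def)
    have gd: "g ^ d \<le> g" "g ^ d > 0" using g d power_decreasing[of 1 d g] by auto
    have "g ^ (s - 1) / (g ^ (s - 1) - g ^ (r - 1)) = - (g ^ d / (1 - g ^ d))"
      using g gd unfolding d(2) by (simp add: power_add divide_simps) (simp add: algebra_simps)
    hence "\<bar>g ^ (s - 1) / (g ^ (s - 1) - g ^ (r - 1))\<bar> = g ^ d * (1 / (1 - g ^ d))"
      using g gd by simp
    also have "\<dots> \<le> g * exp (g ^ d / (1 - g))" using geo[OF d(1)] g gd by (intro mult_mono) auto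
    finally show ?thesis using True by (simp add: d_def)
  next
    case False
    define d where "d = r - s"
    have d: "d \<ge> 1" "r - 1 = (s - 1) + d" using False assms by (auto simp: d_def)
    have gd: "g ^ d \<le> g" "g ^ d > 0" using g d power_decreasing[of 1 d g] by auto
    have "g ^ (s - 1) / (g ^ (s - 1) - g ^ (r - 1)) = 1 / (1 - g ^ d)"
      using g gd unfolding d(2) by (simp add: power_add divide_simps) (simp add: algebra_simps)
    hence "\<bar>g ^ (s - 1) / (g ^ (s - 1) - g ^ (r - 1))\<bar> = 1 / (1 - g ^ d)" using g gd by simp
    thus ?thesis using geo[OF d(1)] False by (simp add: d_def)
  qed
qed

lemma sum_powers_le_geometric:
  fixes g :: real
  assumes "0 < g" "g < 1" "finite A" "inj_on f A"
  shows "(\<Sum>s\<in>A. g ^ f s) \<le> 1 / (1 - g)"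
proof -
  have "(\<Sum>s\<in>A. g ^ f s) = (\<Sum>n\<in>f ` A. g ^ n)" using assms by (simp add: sum.reindex)
  also have "\<dots> \<le> (\<Sum>n. g ^ n)" using assms by (intro sum_le_suminf) (auto intro: summable_geometric)
  also have "\<dots> = 1 / (1 - g)" using assms by (intro suminf_geometric) auto
  finally show ?thesis .
qed

text \<open>
  Each index \<open>s > r\<close> contributes at least one factor \<open>g\<close> to the weight of \<open>r\<close>. The remaining factors
  \<open>1 / (1 - g ^ d)\<close> are at most \<open>exp (g ^ d / (1 - g))\<close>, and every distance \<open>d\<close> occurs at most twice, so that
  their product is bounded uniformly in \<open>R\<close> by two geometric series in the exponent.
\<close>

lemma geometric_lagrange_weight_le:
  fixes g :: real
  assumes g: "0 < g" "g < 1" and r: "r \<in> {1..R}"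
  shows "\<bar>\<Prod>s\<in>{1..R} - {r}. g ^ (s - 1) / (g ^ (s - 1) - g ^ (r - 1))\<bar>
           \<le> exp (2 / (1 - g)\<^sup>2) * g ^ (R - r)"
proof -
  let ?d = "\<lambda>s. if r < s then s - r else r - s"
  have "\<bar>\<Prod>s\<in>{1..R} - {r}. g ^ (s - 1) / (g ^ (s - 1) - g ^ (r - 1))\<bar>
      \<le> (\<Prod>s\<in>{1..R} - {r}. (if r < s then g else 1) * exp (g ^ ?d s / (1 - g)))"
    unfolding abs_prod by (intro prod_mono conjI geometric_node_factor_le g) (use r in auto)
  also have "\<dots> = (\<Prod>s\<in>{1..R} - {r}. if r < s then g else 1) * exp ((\<Sum>s\<in>{1..R} - {r}. g ^ ?d s) / (1 - g))"
    by (simp add: prod.distrib exp_sum sum_divide_distrib)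
  also have "(\<Prod>s\<in>{1..R} - {r}. if r < s then g else 1) = (\<Prod>s\<in>{r<..R}. g)"
    using r by (intro prod.mono_neutral_cong_right) auto
  also have "\<dots> = g ^ (R - r)" by simp
  also have "exp ((\<Sum>s\<in>{1..R} - {r}. g ^ ?d s) / (1 - g)) \<le> exp (2 / (1 - g)\<^sup>2)"
  proof -
    have "(\<Sum>s\<in>{1..R} - {r}. g ^ ?d s) = (\<Sum>s\<in>{1..<r} \<union> {r<..R}. g ^ ?d s)"
      using r by (intro sum.cong) auto
    also have "\<dots> = (\<Sum>s\<in>{1..<r}. g ^ (r - s)) + (\<Sum>s\<in>{r<..R}. g ^ (s - r))"
      by (subst sum.union_disjoint) auto
    also have "\<dots> \<le> 1 / (1 - g) + 1 / (1 - g)"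
      using g by (intro add_mono sum_powers_le_geometric) (auto simp: inj_on_def)
    finally show ?thesis using g by (simp add: power2_eq_square divide_simps)
  qed
  finally show ?thesis using g by (simp add: mult_ac)
qed

section \<open>Levels of the estimator\<close>

lemma step_grid_bounds:
  assumes "hmax > 0" "h \<in> step_grid hmax"
  shows "0 < h" "h \<le> hmax"
  using assms by (auto simp: step_grid_def divide_le_eq mult_le_cancel_left1)

lemma step_grid_refine:
  assumes "M \<ge> 1" "h \<in> step_grid hmax"
  shows "h / refiner M j \<in> step_grid hmax"
proof -
  obtain n where n: "n \<ge> 1" "h = hmax / real n" using assms by (auto simp: step_grid_def)
  have "h / refiner M j = hmax / real (n * M ^ (j - 1))" by (simp add: n refiner_def)
  moreover have "n * M ^ (j - 1) \<ge> 1" using n assms by simp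
  ultimately show ?thesis unfolding step_grid_def by blast
qed

lemma refined_step_powr:
  assumes "M \<ge> 1" "h \<ge> 0" "j \<ge> 1"
  shows "(h / refiner M j) powr b = h powr b * real M powr (- b * (real j - 1))"
proof -
  have "refiner M j = real M powr (real j - 1)"
    using assms by (simp add: refiner_def of_nat_diff flip: powr_realpow)
  hence "refiner M j powr b = real M powr (b * (real j - 1))"
    by (simp add: powr_powr mult_ac)
  thus ?thesis using assms by (simp add: powr_divide refiner_def powr_minus_divide)
qed

text \<open>
  A level reads only one copy of the whole family, so its samples are measurable images of the
  independent paths.
\<close>

definition level_functional :: "nat \<Rightarrow> real \<Rightarrow> nat \<Rightarrow> (real \<Rightarrow> real) \<Rightarrow> real" where
  "level_functional M h j g = (if j = 1 then g h else g (h / refiner M j) - g (h / refiner M (j - 1)))"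

definition level_coeff :: "nat \<Rightarrow> (nat \<Rightarrow> nat \<Rightarrow> real) \<Rightarrow> nat \<Rightarrow> (nat \<Rightarrow> nat) \<Rightarrow> nat \<Rightarrow> real" where
  "level_coeff M W R n j = (if j = 1 then 1 else W R j) / real (n j)"

locale multilevel_model = prob_space P for P :: "'a measure" +
  fixes hmax :: real and Y :: "real \<Rightarrow> 'a \<Rightarrow> real"
    and Yc :: "nat \<Rightarrow> nat \<Rightarrow> real \<Rightarrow> 'a \<Rightarrow> real"
    and M :: nat and p \<beta> V :: real
  assumes hmax: "hmax > 0" and M: "M \<ge> 2"
    and Y_measurable: "\<And>h. h \<in> insert 0 (step_grid hmax) \<Longrightarrow> Y h \<in> borel_measurable P"
    and copies: "independent_copies P hmax Y Yc"
    and p: "p \<ge> 2"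
    and Y0_moment: "integrable P (\<lambda>\<omega>. \<bar>Y 0 \<omega>\<bar> powr p)"
    and \<beta>: "\<beta> > 0" and V: "V \<ge> 0"
    and strong: "strong_error P hmax Y p \<beta> V"
begin

lemma path_measurable [measurable]: "path hmax Y \<in> measurable P (path_space hmax)"
  unfolding path_def using Y_measurable by (intro measurable_restrict) auto

lemma copies_indep:
  "indep_vars (\<lambda>_. path_space hmax) (\<lambda>(j, k). path hmax (Yc j k)) ({1..} \<times> {1..})"
  using copies by (simp add: independent_copies_def)

lemma copy_measurable:
  assumes "j \<ge> 1" "k \<ge> 1"
  shows "path hmax (Yc j k) \<in> measurable P (path_space hmax)"
  using copies_indep assms unfolding indep_vars_def by auto

lemma copy_law:
  assumes "j \<ge> 1" "k \<ge> 1" and f[measurable]: "f \<in> borel_measurable (path_space hmax)"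
  shows "integrable P (\<lambda>\<omega>. f (path hmax (Yc j k) \<omega>)) \<longleftrightarrow> integrable P (\<lambda>\<omega>. f (path hmax Y \<omega>) :: real)"
    and "expectation (\<lambda>\<omega>. f (path hmax (Yc j k) \<omega>)) = expectation (\<lambda>\<omega>. f (path hmax Y \<omega>))"
proof -
  note [measurable] = copy_measurable[OF assms(1,2)]
  have "distr P (path_space hmax) (path hmax (Yc j k)) = distr P (path_space hmax) (path hmax Y)"
    using copies assms by (simp add: independent_copies_def)
  thus "integrable P (\<lambda>\<omega>. f (path hmax (Yc j k) \<omega>)) \<longleftrightarrow> integrable P (\<lambda>\<omega>. f (path hmax Y \<omega>))"
    and "expectation (\<lambda>\<omega>. f (path hmax (Yc j k) \<omega>)) = expectation (\<lambda>\<omega>. f (path hmax Y \<omega>))"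
    by (metis (no_types) integrable_distr_eq[OF _ f] copy_measurable[OF assms(1,2)] path_measurable,
        metis (no_types) integral_distr[OF _ f] copy_measurable[OF assms(1,2)] path_measurable)
qed

lemma level_functional_measurable:
  assumes "h \<in> step_grid hmax"
  shows "level_functional M h j \<in> borel_measurable (path_space hmax)"
proof -
  have [measurable]: "(\<lambda>g. g (h / refiner M i)) \<in> borel_measurable (path_space hmax)" for i
    using step_grid_refine[of M h hmax i] M assms by (intro measurable_component_singleton) auto
  have [measurable]: "(\<lambda>g. g h) \<in> borel_measurable (path_space hmax)"
    using assms by (intro measurable_component_singleton) auto
  show ?thesis unfolding level_functional_def by measurable
qed

lemma level_functional_path:
  assumes "h \<in> step_grid hmax"
  shows "level_functional M h j (path hmax X \<omega>) =
    (if j = 1 then X h \<omega> else X (h / refiner M j) \<omega> - X (h / refiner M (j - 1)) \<omega>)"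
  using assms step_grid_refine[of M h hmax] M by (simp add: level_functional_def path_def)

text \<open>
  Replacing \<open>V\<close> by \<open>V + 1\<close> makes the constant strictly positive also for \<open>V = 0\<close>; moment bounds with a
  positive right-hand side are what the comparison of moments requires.
\<close>

definition strong_const :: real where
  "strong_const = (V + 1) powr (1 / p)"

lemma strong_const_pos: "strong_const > 0" and strong_const_powr: "strong_const powr p = V + 1"
  using V p by (auto simp: strong_const_def powr_powr)

lemma strong_moment:
  assumes h: "h \<in> step_grid hmax"
  shows "integrable P (\<lambda>\<omega>. \<bar>Y h \<omega> - Y 0 \<omega>\<bar> powr p)"
    and "expectation (\<lambda>\<omega>. \<bar>Y h \<omega> - Y 0 \<omega>\<bar> powr p) \<le> (strong_const * h powr (\<beta> / 2)) powr p"
proof -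
  show "integrable P (\<lambda>\<omega>. \<bar>Y h \<omega> - Y 0 \<omega>\<bar> powr p)" using strong h by (simp add: strong_error_def)
  have "expectation (\<lambda>\<omega>. \<bar>Y h \<omega> - Y 0 \<omega>\<bar> powr p) \<le> V * h powr (\<beta> / 2 * p)"
    using strong h by (simp add: strong_error_def)
  also have "\<dots> \<le> (V + 1) * h powr (\<beta> / 2 * p)" by (intro mult_right_mono) auto
  also have "\<dots> = (strong_const * h powr (\<beta> / 2)) powr p"
    using strong_const_pos by (simp add: powr_mult strong_const_powr powr_powr)
  finally show "expectation (\<lambda>\<omega>. \<bar>Y h \<omega> - Y 0 \<omega>\<bar> powr p) \<le> (strong_const * h powr (\<beta> / 2)) powr p" .
qed

lemma Y_integrable:
  assumes "h \<in> insert 0 (step_grid hmax)"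
  shows "integrable P (Y h)"
proof -
  have int: "integrable P X" if [measurable]: "X \<in> borel_measurable P"
    and int: "integrable P (\<lambda>\<omega>. \<bar>X \<omega>\<bar> powr p)" for X
  proof (rule moment_centered_le(1)[where p = p])
    define E where "E = expectation (\<lambda>\<omega>. \<bar>X \<omega>\<bar> powr p)"
    have E: "E \<ge> 0" unfolding E_def by (rule integral_nonneg_AE) simp
    hence "((E + 1) powr (1 / p)) powr p = E + 1" using p by (simp add: powr_powr)
    thus "expectation (\<lambda>\<omega>. \<bar>X \<omega>\<bar> powr p) \<le> ((E + 1) powr (1 / p)) powr p"
      by (simp add: E_def)
    show "(E + 1) powr (1 / p) > 0" using E by simp
    show "1 \<le> p" using p by simp
  qed (fact that)+
  have 0: "integrable P (Y 0)" by (rule int[OF Y_measurable Y0_moment]) simp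
  show ?thesis
  proof (cases "h = 0")
    case False
    hence h: "h \<in> step_grid hmax" using assms by auto
    have "integrable P (\<lambda>\<omega>. Y h \<omega> - Y 0 \<omega>)"
      by (rule int[OF borel_measurable_diff strong_moment(1)[OF h]]) (use h in \<open>auto intro: Y_measurable\<close>)
    from Bochner_Integration.integrable_add[OF this 0] show ?thesis by simp
  qed (use 0 in simp)
qed

lemma mean_error_le:
  assumes h: "h \<in> step_grid hmax"
  shows "\<bar>expectation (Y h) - expectation (Y 0)\<bar> \<le> 2 * strong_const * h powr (\<beta> / 2)"
proof -
  have "h > 0" using step_grid_bounds[OF hmax h] by simp
  hence "\<bar>expectation (\<lambda>\<omega>. Y h \<omega> - Y 0 \<omega>)\<bar> \<le> 2 * (strong_const * h powr (\<beta> / 2))"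
    by (intro moment_centered_le(2)[OF _ _ strong_moment[OF h]] borel_measurable_diff Y_measurable)
       (use p h strong_const_pos in auto)
  thus ?thesis using h by (simp add: Y_integrable)
qed

definition coarse_const :: real where
  "coarse_const = (2 powr p * (expectation (\<lambda>\<omega>. \<bar>Y 0 \<omega>\<bar> powr p)
      + (strong_const * hmax powr (\<beta> / 2)) powr p)) powr (1 / p)"

definition correction_const :: real where
  "correction_const = (2 powr p * (strong_const powr p
      + (strong_const * real M powr (\<beta> / 2)) powr p)) powr (1 / p)"

definition level_bound :: "real \<Rightarrow> nat \<Rightarrow> real" where
  "level_bound h j = (if j = 1 then coarse_const
     else correction_const * (h powr (\<beta> / 2) * real M powr (- (\<beta> / 2) * (real j - 1))))"

lemma coarse_const_pos: "coarse_const > 0" and correction_const_pos: "correction_const > 0"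
proof -
  have "strong_const * hmax powr (\<beta> / 2) > 0" using strong_const_pos hmax by simp
  hence "expectation (\<lambda>\<omega>. \<bar>Y 0 \<omega>\<bar> powr p) + (strong_const * hmax powr (\<beta> / 2)) powr p > 0"
    by (intro add_nonneg_pos) auto
  thus "coarse_const > 0" by (simp add: coarse_const_def)
  have "strong_const powr p + (strong_const * real M powr (\<beta> / 2)) powr p > 0"
    using strong_const_pos by (intro add_pos_nonneg) auto
  thus "correction_const > 0" by (simp add: correction_const_def)
qed

lemma level_bound_pos:
  assumes "h > 0" shows "level_bound h j > 0"
  using assms coarse_const_pos correction_const_pos M by (simp add: level_bound_def)

text \<open>
  The coarse level is controlled by the \<open>p\<close>-th moment of \<open>Y 0\<close> and one strong error; a correction is a
  difference of two strong errors at steps which differ by the factor \<open>M\<close>, and is therefore of the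
  order of the finer one.
\<close>

lemma level_moment:
  assumes h: "h \<in> step_grid hmax" and j: "j \<ge> 1"
  shows "integrable P (\<lambda>\<omega>. \<bar>level_functional M h j (path hmax Y \<omega>)\<bar> powr p)"
    and "expectation (\<lambda>\<omega>. \<bar>level_functional M h j (path hmax Y \<omega>)\<bar> powr p) \<le> level_bound h j powr p"
proof -
  have h0: "h > 0" "h \<le> hmax" using step_grid_bounds[OF hmax h] by auto
  have p0: "p \<ge> 0" using p by simp
  have [measurable]: "Y 0 \<in> borel_measurable P" using Y_measurable by auto
  have meas: "(\<lambda>\<omega>. Y h \<omega> - Y 0 \<omega>) \<in> borel_measurable P" if "h \<in> step_grid hmax" for h
    using Y_measurable[of h] that by auto
  have "integrable P (\<lambda>\<omega>. \<bar>level_functional M h j (path hmax Y \<omega>)\<bar> powr p) \<and>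
    expectation (\<lambda>\<omega>. \<bar>level_functional M h j (path hmax Y \<omega>)\<bar> powr p) \<le> level_bound h j powr p"
  proof (cases "j = 1")
    case True
    have "expectation (\<lambda>\<omega>. \<bar>Y h \<omega> - Y 0 \<omega>\<bar> powr p) \<le> (strong_const * hmax powr (\<beta> / 2)) powr p"
      using h0 \<beta> p strong_const_pos
      by (intro order_trans[OF strong_moment(2)[OF h]] powr_mono2 mult_left_mono) auto
    note * = moment_add_le[OF p0 _ meas[OF h] Y0_moment strong_moment(1)[OF h] order_refl this]
    have "level_bound h j powr p = 2 powr p * (expectation (\<lambda>\<omega>. \<bar>Y 0 \<omega>\<bar> powr p)
      + (strong_const * hmax powr (\<beta> / 2)) powr p)"
      using True p coarse_const_pos
      by (auto simp: level_bound_def coarse_const_def powr_powr intro!: add_nonneg_nonneg)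
    with * show ?thesis using True h by (simp add: level_functional_path)
  next
    case False
    define a where "a = h / refiner M j"
    define b where "b = h / refiner M (j - 1)"
    have ab: "a \<in> step_grid hmax" "b \<in> step_grid hmax"
      unfolding a_def b_def using M by (auto intro!: step_grid_refine h)
    have a0: "a > 0" using step_grid_bounds[OF hmax ab(1)] by simp
    have b: "b = real M * a"
    proof -
      have "j - 1 = Suc (j - 2)" using False j by simp
      thus ?thesis using M by (simp add: a_def b_def refiner_def)
    qed
    have sm: "integrable P (\<lambda>\<omega>. \<bar>- (Y b \<omega> - Y 0 \<omega>)\<bar> powr p)"
        "expectation (\<lambda>\<omega>. \<bar>- (Y b \<omega> - Y 0 \<omega>)\<bar> powr p) \<le> (strong_const * b powr (\<beta> / 2)) powr p"
      unfolding abs_minus_cancel by (fact strong_moment[OF ab(2)])+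
    have mb: "(\<lambda>\<omega>. - (Y b \<omega> - Y 0 \<omega>)) \<in> borel_measurable P"
      using meas[OF ab(2)] by (rule borel_measurable_uminus)
    note * = moment_add_le[OF p0 meas[OF ab(1)] mb strong_moment(1)[OF ab(1)] sm(1) strong_moment(2)[OF ab(1)] sm(2)]
    have "2 powr p * ((strong_const * a powr (\<beta> / 2)) powr p + (strong_const * b powr (\<beta> / 2)) powr p)
        = level_bound h j powr p"
    proof -
      have "level_bound h j = correction_const * a powr (\<beta> / 2)"
        using False j h0 refined_step_powr[of M h j "\<beta> / 2"] M by (simp add: level_bound_def a_def)
      moreover have "correction_const powr p
          = 2 powr p * (strong_const powr p + (strong_const * real M powr (\<beta> / 2)) powr p)"
        using p unfolding correction_const_def by (simp add: powr_powr)
      ultimately show ?thesis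
        using b a0 by (simp add: powr_mult algebra_simps)
    qed
    with * show ?thesis using False h by (simp add: level_functional_path a_def b_def)
  qed
  thus "integrable P (\<lambda>\<omega>. \<bar>level_functional M h j (path hmax Y \<omega>)\<bar> powr p)"
    and "expectation (\<lambda>\<omega>. \<bar>level_functional M h j (path hmax Y \<omega>)\<bar> powr p) \<le> level_bound h j powr p"
    by auto
qed

lemma ml_estimator_eq_sum:
  fixes q :: "nat \<Rightarrow> real" and N :: real
  assumes h: "h \<in> step_grid hmax" and R: "R \<ge> 1"
  defines "n \<equiv> \<lambda>j. nat \<lceil>N * q j\<rceil>"
  shows "ml_estimator Yc M W h R q N \<omega> =
    (\<Sum>j=1..R. \<Sum>k=1..n j. level_coeff M W R n j * level_functional M h j (path hmax (Yc j k) \<omega>))"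
proof -
  have "{1..R} = insert 1 {2..R}" using R by auto
  thus ?thesis
    by (simp add: ml_estimator_def Let_def n_def level_coeff_def level_functional_path[OF h] sum_distrib_left)
qed

text \<open>
  The type 2 inequality applied to all samples of all levels at once; centring a sample multiplies its
  \<open>L\<^sup>p\<close> bound by at most \<open>8\<close>.
\<close>

lemma centered_sum_moment_le:
  fixes n :: "nat \<Rightarrow> nat" and a :: "nat \<Rightarrow> real" and R :: nat
  assumes h: "h \<in> step_grid hmax"
  defines "m \<equiv> \<lambda>j. expectation (\<lambda>\<omega>. level_functional M h j (path hmax Y \<omega>))"
  defines "D \<equiv> \<lambda>\<omega>. (\<Sum>j=1..R. \<Sum>k=1..n j. a j * level_functional M h j (path hmax (Yc j k) \<omega>))
                  - (\<Sum>j=1..R. real (n j) * a j * m j)"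
  shows "D \<in> borel_measurable P"
    and "integrable P (\<lambda>\<omega>. \<bar>D \<omega>\<bar> powr p)"
    and "expectation (\<lambda>\<omega>. \<bar>D \<omega>\<bar> powr p)
      \<le> (8 * taylor_const p * (\<Sum>j=1..R. real (n j) * (a j * (8 * level_bound h j))\<^sup>2)) powr (p / 2)"
proof -
  have h0: "h > 0" using step_grid_bounds[OF hmax h] by simp
  define I where "I = (SIGMA j:{1..R}. {1..n j})"
  define X where "X = (\<lambda>(j, k) \<omega>. a j * (level_functional M h j (path hmax (Yc j k) \<omega>) - m j))"
  define x where "x = (\<lambda>(j, k :: nat). \<bar>a j\<bar> * (8 * level_bound h j))"
  have [simp]: "finite I" by (auto simp: I_def)
  have I: "j \<ge> 1" "k \<ge> 1" if "(j, k) \<in> I" for j k using that by (auto simp: I_def)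
  note meas = level_functional_measurable[OF h]
  have D_eq: "D = (\<lambda>\<omega>. \<Sum>i\<in>I. X i \<omega>)"
  proof
    fix \<omega>
    have "(\<Sum>i\<in>I. X i \<omega>) = (\<Sum>j=1..R. \<Sum>k=1..n j. a j * (level_functional M h j (path hmax (Yc j k) \<omega>) - m j))"
      unfolding I_def X_def by (subst sum.Sigma) (auto simp: case_prod_unfold)
    also have "\<dots> = D \<omega>"
      by (simp add: D_def right_diff_distrib sum_subtractf mult_ac)
    finally show "D \<omega> = (\<Sum>i\<in>I. X i \<omega>)" by simp
  qed
  have ind: "indep_vars (\<lambda>_. borel) X I"
  proof -
    have "indep_vars (\<lambda>_. path_space hmax) (\<lambda>(j, k). path hmax (Yc j k)) I"
      by (rule indep_vars_subset[OF copies_indep]) (auto dest: I)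
    from indep_vars_compose2[OF this, of "\<lambda>(j, k) g. a j * (level_functional M h j g - m j)" "\<lambda>_. borel"]
    show ?thesis using meas by (auto simp: X_def case_prod_unfold)
  qed
  have Xm: "X i \<in> borel_measurable P" if "i \<in> I" for i
    using ind that unfolding indep_vars_def by auto
  thus "D \<in> borel_measurable P" unfolding D_eq by simp
  have X: "integrable P (\<lambda>\<omega>. \<bar>X i \<omega>\<bar> powr p) \<and> expectation (X i) = 0 \<and>
      expectation (\<lambda>\<omega>. \<bar>X i \<omega>\<bar> powr p) \<le> x i powr p \<and> x i \<ge> 0" if i: "i \<in> I" for i
  proof -
    obtain j k where jk: "i = (j, k)" by force
    note jk1 = I[OF i[unfolded jk]]
    have l: "level_bound h j > 0" by (rule level_bound_pos[OF h0])
    have mm: "(\<lambda>\<omega>. level_functional M h j (path hmax Y \<omega>)) \<in> borel_measurable P"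
      by (rule measurable_compose[OF path_measurable meas])
    note c = moment_centered_le[OF _ mm level_moment[OF h jk1(1)] l]
    note law = copy_law[OF jk1]
    have f: "(\<lambda>g. \<bar>a j * (level_functional M h j g - m j)\<bar> powr p) \<in> borel_measurable (path_space hmax)"
      using meas by measurable
    have f1: "(\<lambda>g. a j * (level_functional M h j g - m j)) \<in> borel_measurable (path_space hmax)"
      using meas by measurable
    have c1: "integrable P (\<lambda>\<omega>. level_functional M h j (path hmax Y \<omega>))"
      and c3: "integrable P (\<lambda>\<omega>. \<bar>level_functional M h j (path hmax Y \<omega>) - m j\<bar> powr p)"
      and c4: "expectation (\<lambda>\<omega>. \<bar>level_functional M h j (path hmax Y \<omega>) - m j\<bar> powr p) \<le> (8 * level_bound h j) powr p"
      using c p by (auto simp: m_def)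
    have "integrable P (\<lambda>\<omega>. \<bar>X i \<omega>\<bar> powr p)"
      unfolding X_def jk using law(1)[OF f] c3 by (simp add: abs_mult powr_mult)
    moreover have "expectation (X i) = 0"
      unfolding X_def jk using law(2)[OF f1] c1 by (simp add: m_def prob_space)
    moreover have "expectation (\<lambda>\<omega>. \<bar>X i \<omega>\<bar> powr p) \<le> x i powr p"
    proof -
      have "expectation (\<lambda>\<omega>. \<bar>X i \<omega>\<bar> powr p)
          = \<bar>a j\<bar> powr p * expectation (\<lambda>\<omega>. \<bar>level_functional M h j (path hmax Y \<omega>) - m j\<bar> powr p)"
        unfolding X_def jk prod.case law(2)[OF f] by (simp add: abs_mult powr_mult)
      also have "\<dots> \<le> \<bar>a j\<bar> powr p * (8 * level_bound h j) powr p"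
        by (intro mult_left_mono c4) simp
      also have "\<dots> = x i powr p" using l by (simp add: x_def jk powr_mult)
      finally show ?thesis .
    qed
    moreover have "x i \<ge> 0" using l by (simp add: x_def jk)
    ultimately show ?thesis by blast
  qed
  have "(\<Sum>i\<in>I. (x i)\<^sup>2) = (\<Sum>j=1..R. \<Sum>k=1..n j. (a j * (8 * level_bound h j))\<^sup>2)"
    unfolding I_def x_def by (subst sum.Sigma) (auto simp: case_prod_unfold power_mult_distrib)
  also have "\<dots> = (\<Sum>j=1..R. real (n j) * (a j * (8 * level_bound h j))\<^sup>2)" by simp
  finally have x_eq: "(\<Sum>i\<in>I. (x i)\<^sup>2) = (\<Sum>j=1..R. real (n j) * (a j * (8 * level_bound h j))\<^sup>2)" .
  show "integrable P (\<lambda>\<omega>. \<bar>D \<omega>\<bar> powr p)" unfolding D_eq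
    by (rule moment_sum_indep_centered_le(1)[OF p _ ind, where x = x]) (use X in auto)
  show "expectation (\<lambda>\<omega>. \<bar>D \<omega>\<bar> powr p)
      \<le> (8 * taylor_const p * (\<Sum>j=1..R. real (n j) * (a j * (8 * level_bound h j))\<^sup>2)) powr (p / 2)"
    unfolding D_eq x_eq[symmetric]
    by (rule moment_sum_indep_centered_le(2)[OF p _ ind, where x = x]) (use X in auto)
qed

end

section \<open>Fluctuation under the sample allocation\<close>

definition cost_sum :: "nat \<Rightarrow> real \<Rightarrow> (nat \<Rightarrow> nat \<Rightarrow> real) \<Rightarrow> nat \<Rightarrow> real" where
  "cost_sum M \<beta> W R = (\<Sum>j=2..R. \<bar>W R j\<bar> * real M powr ((1 - \<beta>) / 2 * (real j - 1)))"

text \<open>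
  The normalization \<open>\<mu>\<^sup>*\<close> cancels, since it is a factor of \<open>q\<close> and divides \<open>N\<close>; the real-valued sample
  size of a level is thus explicit.
\<close>

lemma N_opt_q_opt_eq:
  assumes "\<theta> > 0" "h > 0" "M \<ge> 1" "R \<ge> 1" "\<epsilon> > 0"
  shows "N_opt \<rho> v \<theta> \<beta> M W h R \<epsilon> * q_opt \<theta> \<beta> M W h R j =
    \<rho> * v * (1 + \<theta> * h powr (\<beta> / 2) + \<theta> * h powr (\<beta> / 2) * C_upper M \<beta> * cost_sum M \<beta> W R)
      * q_unnormalized \<theta> \<beta> M W h R j / \<epsilon>\<^sup>2"
proof -
  have C: "C_lower M \<beta> \<ge> 0" by (simp add: C_lower_def)
  have "0 < q_unnormalized \<theta> \<beta> M W h R 1"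
    using assms by (simp add: q_unnormalized_def add_pos_nonneg)
  also have "\<dots> \<le> (\<Sum>j=1..R. q_unnormalized \<theta> \<beta> M W h R j)"
    using assms C by (intro member_le_sum) (auto simp: q_unnormalized_def)
  finally have "mu_star \<theta> \<beta> M W h R \<noteq> 0" by (simp add: mu_star_def)
  thus ?thesis by (simp add: N_opt_def q_opt_def cost_sum_def)
qed

text \<open>
  The share of one correction level in the variance. As the sample size is proportional to \<open>\<bar>w\<bar>\<close> and to
  \<open>M powr (- (1 + \<beta>) / 2 * s)\<close>, dividing \<open>w\<^sup>2\<close> times the squared level size by it leaves exactly the
  summand of the cost sum, which the factor \<open>A\<close> contained in the sample size compensates after
  summation.
\<close>

lemma level_variance_share:
  fixes w s c A \<theta> C v \<epsilon> N :: real
  assumes pos: "\<theta> > 0" "C > 0" "v > 0" "\<epsilon> > 0" "A > 0" "M > 0" "h > 0"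
    and N: "N \<ge> v * A * (\<theta> * h powr (\<beta> / 2) * C * \<bar>w\<bar> * M powr (- ((1 + \<beta>) / 2) * s)) / \<epsilon>\<^sup>2"
  shows "w\<^sup>2 * (c * (h powr (\<beta> / 2) * M powr (- (\<beta> / 2) * s)))\<^sup>2 / N
      \<le> \<epsilon>\<^sup>2 * (c\<^sup>2 / (v * \<theta> * C * A)) * (h powr (\<beta> / 2) * (\<bar>w\<bar> * M powr ((1 - \<beta>) / 2 * s)))"
proof (cases "w = 0")
  case False
  define H where "H = h powr (\<beta> / 2)"
  define m where "m = M powr (- ((1 + \<beta>) / 2) * s)"
  define N' where "N' = v * A * (\<theta> * H * C * \<bar>w\<bar> * m) / \<epsilon>\<^sup>2"
  have H: "H > 0" and m: "m > 0" using pos by (auto simp: H_def m_def)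
  have N': "N' > 0" using pos False H m by (simp add: N'_def)
  have mm: "(M powr (- (\<beta> / 2) * s))\<^sup>2 = m * M powr ((1 - \<beta>) / 2 * s)"
  proof -
    have "(M powr (- (\<beta> / 2) * s))\<^sup>2 = M powr (- (\<beta> / 2) * s + - (\<beta> / 2) * s)"
      by (simp only: power2_eq_square powr_add)
    also have "- (\<beta> / 2) * s + - (\<beta> / 2) * s = - ((1 + \<beta>) / 2) * s + (1 - \<beta>) / 2 * s"
      by (simp add: field_simps)
    finally show ?thesis by (simp only: powr_add m_def)
  qed
  have "w\<^sup>2 * (c * (H * M powr (- (\<beta> / 2) * s)))\<^sup>2 / N \<le> w\<^sup>2 * (c * (H * M powr (- (\<beta> / 2) * s)))\<^sup>2 / N'"
  proof -
    have "N' \<le> N" using N by (simp only: N'_def H_def m_def)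
    thus ?thesis using N' by (intro divide_left_mono mult_pos_pos) auto
  qed
  also have "\<dots> = w\<^sup>2 * (c\<^sup>2 * (H\<^sup>2 * (m * M powr ((1 - \<beta>) / 2 * s)))) / N'"
    by (simp only: power_mult_distrib mm)
  also have "\<dots> = \<epsilon>\<^sup>2 * (c\<^sup>2 / (v * \<theta> * C * A)) * (H * (\<bar>w\<bar> * M powr ((1 - \<beta>) / 2 * s)))"
  proof -
    have "w\<^sup>2 = \<bar>w\<bar> * \<bar>w\<bar>" by (simp add: power2_eq_square)
    thus ?thesis using pos False H m unfolding N'_def
      by (simp add: divide_simps) (simp add: power2_eq_square)
  qed
  finally show ?thesis by (simp add: H_def)
qed simp

lemma C_pos: "C_lower M \<beta> > 0" "C_upper M \<beta> > 0"
  by (auto simp: C_lower_def C_upper_def add_pos_nonneg intro!: divide_pos_pos mult_pos_pos)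

context multilevel_model
begin

definition variance_budget :: "real \<Rightarrow> real \<Rightarrow> real" where
  "variance_budget \<theta> v = coarse_const\<^sup>2 / v
     + correction_const\<^sup>2 / (v * \<theta>\<^sup>2 * C_lower M \<beta> * C_upper M \<beta>)"

text \<open>
  The allocation is designed so that the level variances add up to an amount of order \<open>\<epsilon>\<^sup>2\<close>. Since
  the \<open>L\<^sup>p\<close> level bounds have the same decay \<open>M powr (- \<beta> / 2 * (j - 1))\<close> as the \<open>L\<^sup>2\<close> ones, the same
  cancellation bounds the sum of squared \<open>L\<^sup>p\<close> norms by a multiple of \<open>\<epsilon>\<^sup>2\<close> that depends neither on
  the weights nor on \<open>R\<close>, \<open>h\<close> and \<open>\<rho>\<close>. Rounding up the sample sizes only decreases the variance, and a level without
  samples has weight \<open>0\<close>, so each level keeps its total weight.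
\<close>

lemma variance_budget_bound:
  fixes W :: "nat \<Rightarrow> nat \<Rightarrow> real" and \<theta> v \<rho> h \<epsilon> :: real and R :: nat
  assumes pos: "\<theta> > 0" "v > 0" "\<rho> \<ge> 1" "\<epsilon> > 0" "R \<ge> 1" and h: "h \<in> step_grid hmax"
  defines "n \<equiv> \<lambda>j. nat \<lceil>N_opt \<rho> v \<theta> \<beta> M W h R \<epsilon> * q_opt \<theta> \<beta> M W h R j\<rceil>"
  shows "(\<Sum>j=1..R. real (n j) * (level_coeff M W R n j * level_bound h j)\<^sup>2) \<le> \<epsilon>\<^sup>2 * variance_budget \<theta> v"
    and "j \<in> {1..R} \<Longrightarrow> real (n j) * level_coeff M W R n j = (if j = 1 then 1 else W R j)"
proof -
  have h0: "h > 0" using step_grid_bounds[OF hmax h] by simp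
  have M1: "M \<ge> 1" using M by simp
  define T where "T = h powr (\<beta> / 2) * cost_sum M \<beta> W R"
  define A where "A = 1 + \<theta> * h powr (\<beta> / 2) + \<theta> * C_upper M \<beta> * T"
  define U where "U = q_unnormalized \<theta> \<beta> M W h R"
  have T: "T \<ge> 0" unfolding T_def cost_sum_def by (intro mult_nonneg_nonneg sum_nonneg) auto
  have A: "A \<ge> 1" "A \<ge> \<theta> * C_upper M \<beta> * T"
    unfolding A_def using pos T C_pos[of M \<beta>] by (auto intro!: add_nonneg_nonneg mult_nonneg_nonneg simp: add_increasing)
  have U0: "U j \<ge> 0" for j using pos C_pos[of M \<beta>] by (simp add: U_def q_unnormalized_def)
  have U1: "U 1 \<ge> 1" using pos by (simp add: U_def q_unnormalized_def)
  have Nq: "real (n j) \<ge> v * A * U j / \<epsilon>\<^sup>2" for j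
  proof -
    have "v * A * U j / \<epsilon>\<^sup>2 \<le> \<rho> * (v * A * U j / \<epsilon>\<^sup>2)"
      using mult_right_mono[of 1 \<rho> "v * A * U j / \<epsilon>\<^sup>2"] pos A U0 by simp
    also have "\<dots> = N_opt \<rho> v \<theta> \<beta> M W h R \<epsilon> * q_opt \<theta> \<beta> M W h R j"
      by (subst N_opt_q_opt_eq[OF pos(1) h0 M1 pos(5,4)]) (simp add: A_def U_def T_def mult_ac)
    also have "\<dots> \<le> real (n j)" unfolding n_def by (rule real_nat_ceiling_ge)
    finally show ?thesis .
  qed
  have n1: "real (n 1) \<ge> v / \<epsilon>\<^sup>2"
  proof -
    have "v * (1 * 1) / \<epsilon>\<^sup>2 \<le> v * (A * U 1) / \<epsilon>\<^sup>2"
      using pos A U1 by (intro divide_right_mono mult_left_mono mult_mono) auto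
    with Nq[of 1] show ?thesis by (simp add: mult_ac)
  qed
  have npos: "real (n j) > 0" if "j = 1 \<or> W R j \<noteq> 0" for j
  proof (cases "j = 1")
    case True
    have "v / \<epsilon>\<^sup>2 > 0" using pos by simp
    with n1 True show ?thesis by simp
  next
    case False
    have "U j > 0" using False that pos C_pos[of M \<beta>] h0 M by (simp add: U_def q_unnormalized_def)
    hence "v * A * U j / \<epsilon>\<^sup>2 > 0" using pos A by simp
    with Nq[of j] show ?thesis by linarith
  qed
  show "real (n j) * level_coeff M W R n j = (if j = 1 then 1 else W R j)"
    using npos[of j] by (cases "j = 1 \<or> W R j \<noteq> 0") (auto simp: level_coeff_def)
  define K where "K = correction_const\<^sup>2 / (v * \<theta> * C_lower M \<beta> * A)"
  have term1: "real (n 1) * (level_coeff M W R n 1 * level_bound h 1)\<^sup>2 \<le> \<epsilon>\<^sup>2 * (coarse_const\<^sup>2 / v)"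
  proof -
    have "real (n 1) * (level_coeff M W R n 1 * level_bound h 1)\<^sup>2 = coarse_const\<^sup>2 / real (n 1)"
      by (simp add: level_coeff_def level_bound_def power_divide power2_eq_square)
    also have "\<dots> \<le> coarse_const\<^sup>2 / (v / \<epsilon>\<^sup>2)"
      using n1 npos[of 1] pos by (intro divide_left_mono) auto
    finally show ?thesis by (simp add: mult_ac)
  qed
  have term2: "real (n j) * (level_coeff M W R n j * level_bound h j)\<^sup>2
      \<le> \<epsilon>\<^sup>2 * K * (h powr (\<beta> / 2) * (\<bar>W R j\<bar> * real M powr ((1 - \<beta>) / 2 * (real j - 1))))"
    if j: "j \<in> {2..R}" for j
  proof -
    have "real (n j) * (level_coeff M W R n j * level_bound h j)\<^sup>2
        = (W R j)\<^sup>2 * (correction_const * (h powr (\<beta> / 2) * real M powr (- (\<beta> / 2) * (real j - 1))))\<^sup>2 / real (n j)"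
      using j by (simp add: level_coeff_def level_bound_def power_divide power_mult_distrib power2_eq_square)
    also have "\<dots> \<le> \<epsilon>\<^sup>2 * K * (h powr (\<beta> / 2) * (\<bar>W R j\<bar> * real M powr ((1 - \<beta>) / 2 * (real j - 1))))"
      unfolding K_def
    proof (rule level_variance_share)
      show "real (n j) \<ge> v * A * (\<theta> * h powr (\<beta> / 2) * C_lower M \<beta> * \<bar>W R j\<bar>
          * real M powr (- ((1 + \<beta>) / 2) * (real j - 1))) / \<epsilon>\<^sup>2"
        using Nq[of j] j by (simp add: U_def q_unnormalized_def)
    qed (use pos C_pos[of M \<beta>] A M h0 in auto)
    finally show ?thesis .
  qed
  have "{1..R} = insert 1 {2..R}" using pos by auto
  hence "(\<Sum>j=1..R. real (n j) * (level_coeff M W R n j * level_bound h j)\<^sup>2)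
      = real (n 1) * (level_coeff M W R n 1 * level_bound h 1)\<^sup>2
        + (\<Sum>j=2..R. real (n j) * (level_coeff M W R n j * level_bound h j)\<^sup>2)" by simp
  also have "\<dots> \<le> \<epsilon>\<^sup>2 * (coarse_const\<^sup>2 / v)
      + (\<Sum>j=2..R. \<epsilon>\<^sup>2 * K * (h powr (\<beta> / 2) * (\<bar>W R j\<bar> * real M powr ((1 - \<beta>) / 2 * (real j - 1)))))"
    by (intro add_mono term1 sum_mono term2)
  also have "\<dots> = \<epsilon>\<^sup>2 * (coarse_const\<^sup>2 / v) + \<epsilon>\<^sup>2 * (K * T)"
    by (simp add: T_def cost_sum_def sum_distrib_left mult_ac)
  also have "K * T \<le> correction_const\<^sup>2 / (v * \<theta>\<^sup>2 * C_lower M \<beta> * C_upper M \<beta>)"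
  proof -
    have "K * T = correction_const\<^sup>2 / (v * \<theta>\<^sup>2 * C_lower M \<beta> * C_upper M \<beta>) * ((\<theta> * C_upper M \<beta> * T) / A)"
      using pos C_pos[of M \<beta>] A by (simp add: K_def power2_eq_square field_simps)
    also have "\<dots> \<le> correction_const\<^sup>2 / (v * \<theta>\<^sup>2 * C_lower M \<beta> * C_upper M \<beta>) * 1"
      using A pos C_pos[of M \<beta>] by (intro mult_left_mono) auto
    finally show ?thesis by simp
  qed
  finally show "(\<Sum>j=1..R. real (n j) * (level_coeff M W R n j * level_bound h j)\<^sup>2) \<le> \<epsilon>\<^sup>2 * variance_budget \<theta> v"
    by (simp add: variance_budget_def distrib_left mult_left_mono)
qed

definition estimator_mean :: "(nat \<Rightarrow> nat \<Rightarrow> real) \<Rightarrow> nat \<Rightarrow> real \<Rightarrow> real" where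
  "estimator_mean W R h = expectation (Y h)
     + (\<Sum>j=2..R. W R j * (expectation (Y (h / refiner M j)) - expectation (Y (h / refiner M (j - 1)))))"

lemma estimator_deviation_le:
  fixes W :: "nat \<Rightarrow> nat \<Rightarrow> real" and \<theta> v \<rho> h \<epsilon> :: real and R :: nat
  assumes pos: "\<theta> > 0" "v > 0" "\<rho> \<ge> 1" "\<epsilon> > 0" "R \<ge> 1" and h: "h \<in> step_grid hmax"
  defines "D \<equiv> \<lambda>\<omega>. ml_estimator Yc M W h R (q_opt \<theta> \<beta> M W h R) (N_opt \<rho> v \<theta> \<beta> M W h R \<epsilon>) \<omega>
                   - estimator_mean W R h"
  shows "D \<in> borel_measurable P"
    and "integrable P (\<lambda>\<omega>. \<bar>D \<omega>\<bar> powr p)"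
    and "expectation (\<lambda>\<omega>. \<bar>D \<omega>\<bar> powr p)
      \<le> (512 * taylor_const p * variance_budget \<theta> v) powr (p / 2) * \<epsilon> powr p"
proof -
  define n where "n = (\<lambda>j. nat \<lceil>N_opt \<rho> v \<theta> \<beta> M W h R \<epsilon> * q_opt \<theta> \<beta> M W h R j\<rceil>)"
  define a where "a = level_coeff M W R n"
  have budget: "(\<Sum>j=1..R. real (n j) * (a j * level_bound h j)\<^sup>2) \<le> \<epsilon>\<^sup>2 * variance_budget \<theta> v"
    and coeff: "j \<in> {1..R} \<Longrightarrow> real (n j) * a j = (if j = 1 then 1 else W R j)" for j
    using variance_budget_bound[OF pos h, where W = W] unfolding n_def a_def by auto
  have mean: "estimator_mean W R h
    = (\<Sum>j=1..R. real (n j) * a j * expectation (\<lambda>\<omega>. level_functional M h j (path hmax Y \<omega>)))"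
  proof -
    have "{1..R} = insert 1 {2..R}" using pos by auto
    moreover have "expectation (\<lambda>\<omega>. Y (h / refiner M j) \<omega> - Y (h / refiner M (j - 1)) \<omega>)
        = expectation (Y (h / refiner M j)) - expectation (Y (h / refiner M (j - 1)))" for j
      using step_grid_refine[OF _ h] M by (intro Bochner_Integration.integral_diff Y_integrable) auto
    ultimately have "estimator_mean W R h = (\<Sum>j=1..R. (if j = 1 then 1 else W R j)
        * expectation (\<lambda>\<omega>. level_functional M h j (path hmax Y \<omega>)))"
      by (simp add: estimator_mean_def level_functional_path[OF h])
    also have "\<dots> = (\<Sum>j=1..R. real (n j) * a j * expectation (\<lambda>\<omega>. level_functional M h j (path hmax Y \<omega>)))"
      by (intro sum.cong refl arg_cong2[where f = "(*)"] coeff[symmetric])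
    finally show ?thesis .
  qed
  have D_eq: "D = (\<lambda>\<omega>. (\<Sum>j=1..R. \<Sum>k=1..n j. a j * level_functional M h j (path hmax (Yc j k) \<omega>))
      - (\<Sum>j=1..R. real (n j) * a j * expectation (\<lambda>\<omega>. level_functional M h j (path hmax Y \<omega>))))"
    unfolding D_def mean by (simp add: ml_estimator_eq_sum[OF h pos(5)] n_def a_def)
  show "D \<in> borel_measurable P" "integrable P (\<lambda>\<omega>. \<bar>D \<omega>\<bar> powr p)"
    unfolding D_eq by (fact centered_sum_moment_le[OF h])+
  have bound: "expectation (\<lambda>\<omega>. \<bar>D \<omega>\<bar> powr p)
      \<le> (8 * taylor_const p * (\<Sum>j=1..R. real (n j) * (a j * (8 * level_bound h j))\<^sup>2)) powr (p / 2)"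
    unfolding D_eq by (fact centered_sum_moment_le[OF h])
  have C: "taylor_const p \<ge> 1" using taylor_const_ge[OF p] by simp
  have budget_nonneg: "variance_budget \<theta> v \<ge> 0"
    using pos C_pos[of M \<beta>] by (simp add: variance_budget_def)
  have "expectation (\<lambda>\<omega>. \<bar>D \<omega>\<bar> powr p)
      \<le> (8 * taylor_const p * (64 * (\<Sum>j=1..R. real (n j) * (a j * level_bound h j)\<^sup>2))) powr (p / 2)"
    using bound by (simp add: power_mult_distrib sum_distrib_left mult_ac)
  also have "\<dots> \<le> (8 * taylor_const p * (64 * (\<epsilon>\<^sup>2 * variance_budget \<theta> v))) powr (p / 2)"
    using p C by (intro powr_mono2 mult_left_mono budget) (auto intro!: mult_nonneg_nonneg sum_nonneg)
  also have "\<dots> = (512 * taylor_const p * variance_budget \<theta> v) powr (p / 2) * (\<epsilon>\<^sup>2) powr (p / 2)"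
    by (subst powr_mult[symmetric]) (simp add: mult_ac)
  also have "(\<epsilon>\<^sup>2) powr (p / 2) = \<epsilon> powr p"
    using pos by (simp add: powr_powr flip: powr_numeral)
  finally show "expectation (\<lambda>\<omega>. \<bar>D \<omega>\<bar> powr p)
      \<le> (512 * taylor_const p * variance_budget \<theta> v) powr (p / 2) * \<epsilon> powr p" .
qed

text \<open>
  The deviation from the mean has \<open>p\<close>-th moments of order \<open>\<epsilon> k powr p\<close>, which are summable. Almost sure
  convergence is thereby reduced to the deterministic convergence of the means.
\<close>

proposition estimator_tendsto_AE:
  fixes W :: "nat \<Rightarrow> nat \<Rightarrow> real" and R :: "nat \<Rightarrow> nat" and h \<rho> \<epsilon> :: "nat \<Rightarrow> real"
  assumes pos: "\<theta> > 0" "v > 0" "\<And>k. \<epsilon> k > 0"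
    and ev: "\<forall>\<^sub>F k in sequentially. R k \<ge> 1 \<and> h k \<in> step_grid hmax \<and> \<rho> k \<ge> 1"
    and summable: "summable (\<lambda>k. \<epsilon> k powr p)"
    and mean: "(\<lambda>k. estimator_mean W (R k) (h k)) \<longlonglongrightarrow> expectation (Y 0)"
  shows "AE \<omega> in P. (\<lambda>k. ml_estimator Yc M W (h k) (R k) (q_opt \<theta> \<beta> M W (h k) (R k))
           (N_opt (\<rho> k) v \<theta> \<beta> M W (h k) (R k) (\<epsilon> k)) \<omega>) \<longlonglongrightarrow> expectation (Y 0)"
proof -
  obtain k0 where k0: "\<And>k. k \<ge> k0 \<Longrightarrow> R k \<ge> 1 \<and> h k \<in> step_grid hmax \<and> \<rho> k \<ge> 1"
    using ev by (auto simp: eventually_sequentially)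
  define I where "I = (\<lambda>k. ml_estimator Yc M W (h k) (R k) (q_opt \<theta> \<beta> M W (h k) (R k))
           (N_opt (\<rho> k) v \<theta> \<beta> M W (h k) (R k) (\<epsilon> k)))"
  define D where "D = (\<lambda>k \<omega>. I k \<omega> - estimator_mean W (R k) (h k))"
  have "AE \<omega> in P. (\<lambda>k. D k \<omega>) \<longlonglongrightarrow> 0"
  proof (rule AE_tendsto_zero_of_summable_moments)
    show "summable (\<lambda>k. (512 * taylor_const p * variance_budget \<theta> v) powr (p / 2) * \<epsilon> k powr p)"
      by (intro summable_mult summable)
    fix k assume "k \<ge> k0"
    note dev = estimator_deviation_le[OF pos(1,2) _ pos(3), where \<rho> = "\<rho> k" and R = "R k" and h = "h k" and W = W]
    from dev k0[OF \<open>k \<ge> k0\<close>] show "D k \<in> borel_measurable P"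
      and "integrable P (\<lambda>\<omega>. \<bar>D k \<omega>\<bar> powr p)"
      and "expectation (\<lambda>\<omega>. \<bar>D k \<omega>\<bar> powr p)
        \<le> (512 * taylor_const p * variance_budget \<theta> v) powr (p / 2) * \<epsilon> k powr p"
      by (auto simp: D_def I_def)
  qed (use p in auto)
  thus ?thesis
  proof (rule AE_mp, intro AE_I2 impI)
    fix \<omega> assume "(\<lambda>k. D k \<omega>) \<longlonglongrightarrow> 0"
    from tendsto_add[OF this mean] show "(\<lambda>k. ml_estimator Yc M W (h k) (R k) (q_opt \<theta> \<beta> M W (h k) (R k))
           (N_opt (\<rho> k) v \<theta> \<beta> M W (h k) (R k) (\<epsilon> k)) \<omega>) \<longlonglongrightarrow> expectation (Y 0)"
      by (simp add: D_def I_def)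
  qed
qed

end

section \<open>Bias\<close>

text \<open>
  Summation by parts: weights on the level corrections that are tails of \<open>w\<close> turn the telescoping
  estimator into the average of the approximations \<open>e r\<close> with weights \<open>w r\<close>.
\<close>

lemma sum_by_parts_tail_weights:
  fixes w e :: "nat \<Rightarrow> real"
  assumes "R \<ge> 1"
  shows "(\<Sum>r=1..R. w r) * e 1 + (\<Sum>j=2..R. (\<Sum>r=j..R. w r) * (e j - e (j - 1))) = (\<Sum>r=1..R. w r * e r)"
  using assms
proof (induction R rule: dec_induct)
  case base
  thus ?case by simp
next
  case (step R)
  have tele: "(\<Sum>j=2..R. e j - e (j - 1)) = e R - e 1"
    using step.hyps by (induction R rule: dec_induct) simp_all
  have "(\<Sum>j=2..Suc R. (\<Sum>r=j..Suc R. w r) * (e j - e (j - 1)))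
      = (\<Sum>j=2..R. (\<Sum>r=j..Suc R. w r) * (e j - e (j - 1))) + w (Suc R) * (e (Suc R) - e R)"
    using step.hyps by simp
  also have "(\<Sum>j=2..R. (\<Sum>r=j..Suc R. w r) * (e j - e (j - 1)))
      = (\<Sum>j=2..R. (\<Sum>r=j..R. w r) * (e j - e (j - 1)) + w (Suc R) * (e j - e (j - 1)))"
    by (intro sum.cong refl) (simp add: distrib_right)
  also have "\<dots> = (\<Sum>j=2..R. (\<Sum>r=j..R. w r) * (e j - e (j - 1))) + w (Suc R) * (e R - e 1)"
    unfolding sum.distrib sum_distrib_left[symmetric] tele ..
  finally show ?case using step.IH by (simp add: algebra_simps)
qed

context multilevel_model
begin

definition mean_rate :: real where
  "mean_rate = real M powr (- (\<beta> / 2))"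

lemma mean_rate: "0 < mean_rate" "mean_rate < 1"
  using M \<beta> by (auto simp: mean_rate_def powr_less_one)

lemma refined_mean_error_le:
  assumes h: "h \<in> step_grid hmax" and r: "r \<ge> 1"
  shows "\<bar>expectation (Y (h / refiner M r)) - expectation (Y 0)\<bar>
           \<le> 2 * strong_const * hmax powr (\<beta> / 2) * mean_rate ^ (r - 1)"
proof -
  have h0: "0 < h" "h \<le> hmax" using step_grid_bounds[OF hmax h] by auto
  have "\<bar>expectation (Y (h / refiner M r)) - expectation (Y 0)\<bar>
      \<le> 2 * strong_const * (h / refiner M r) powr (\<beta> / 2)"
    using M by (intro mean_error_le step_grid_refine h) auto
  also have "(h / refiner M r) powr (\<beta> / 2) = h powr (\<beta> / 2) * mean_rate ^ (r - 1)"
    using M h0 r mean_rate(1)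
    by (simp add: refined_step_powr mean_rate_def powr_powr of_nat_diff flip: powr_realpow)
  also have "2 * strong_const * (h powr (\<beta> / 2) * mean_rate ^ (r - 1))
      \<le> 2 * strong_const * (hmax powr (\<beta> / 2) * mean_rate ^ (r - 1))"
    using h0 \<beta> mean_rate strong_const_pos by (intro mult_left_mono mult_right_mono powr_mono2) auto
  finally show ?thesis by (simp add: mult_ac)
qed

text \<open>
  The weight of level \<open>r\<close> is of order \<open>mean_rate ^ (R - r)\<close> and its mean error of order
  \<open>mean_rate ^ (r - 1)\<close>. The product does not depend on \<open>r\<close>, whence a bias of order
  \<open>R * mean_rate ^ (R - 1)\<close>, uniformly in \<open>h\<close>.
\<close>

lemma estimator_bias_le:
  assumes h: "h \<in> step_grid hmax" and R: "R \<ge> 1"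
    and W: "\<And>j. j \<in> {1..R} \<Longrightarrow> W R j = (\<Sum>r=j..R. w r)"
    and w1: "(\<Sum>r=1..R. w r) = 1"
    and w: "\<And>r. r \<in> {1..R} \<Longrightarrow> \<bar>w r\<bar> \<le> B * mean_rate ^ (R - r)"
  shows "\<bar>estimator_mean W R h - expectation (Y 0)\<bar>
    \<le> B * (2 * strong_const * hmax powr (\<beta> / 2)) * (real R * mean_rate ^ (R - 1))"
proof -
  define e where "e r = expectation (Y (h / refiner M r))" for r
  have "estimator_mean W R h = (\<Sum>r=1..R. w r) * e 1 + (\<Sum>j=2..R. (\<Sum>r=j..R. w r) * (e j - e (j - 1)))"
    unfolding estimator_mean_def w1 e_def by (simp add: W refiner_def)
  also have "\<dots> = (\<Sum>r=1..R. w r * e r)" by (rule sum_by_parts_tail_weights[OF R])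
  finally have "estimator_mean W R h - expectation (Y 0) = (\<Sum>r=1..R. w r * (e r - expectation (Y 0)))"
    using w1 by (simp add: right_diff_distrib sum_subtractf flip: sum_distrib_right)
  also have "\<bar>\<dots>\<bar> \<le> (\<Sum>r=1..R. B * (2 * strong_const * hmax powr (\<beta> / 2)) * mean_rate ^ (R - 1))"
  proof (intro order_trans[OF sum_abs] sum_mono)
    fix r assume r: "r \<in> {1..R}"
    have "\<bar>w r * (e r - expectation (Y 0))\<bar>
        \<le> (B * mean_rate ^ (R - r)) * (2 * strong_const * hmax powr (\<beta> / 2) * mean_rate ^ (r - 1))"
      unfolding abs_mult e_def using r
      by (intro mult_mono w refined_mean_error_le h order_trans[OF abs_ge_zero w]) auto
    also have "\<dots> = B * (2 * strong_const * hmax powr (\<beta> / 2)) * (mean_rate ^ (R - r) * mean_rate ^ (r - 1))"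
      by simp
    also have "mean_rate ^ (R - r) * mean_rate ^ (r - 1) = mean_rate ^ (R - 1)"
      using r by (simp flip: power_add)
    finally show "\<bar>w r * (e r - expectation (Y 0))\<bar>
        \<le> B * (2 * strong_const * hmax powr (\<beta> / 2)) * mean_rate ^ (R - 1)" .
  qed
  also have "\<dots> = B * (2 * strong_const * hmax powr (\<beta> / 2)) * (real R * mean_rate ^ (R - 1))" by simp
  finally show ?thesis .
qed

lemma estimator_mean_tendsto:
  fixes w :: "nat \<Rightarrow> nat \<Rightarrow> real" and R :: "nat \<Rightarrow> nat"
  assumes R: "filterlim R at_top sequentially"
    and h: "\<forall>\<^sub>F k in sequentially. h k \<in> step_grid hmax"
    and W: "\<And>R j. j \<in> {1..R} \<Longrightarrow> W R j = (\<Sum>r=j..R. w R r)"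
    and w1: "\<And>R. R \<ge> 1 \<Longrightarrow> (\<Sum>r=1..R. w R r) = 1"
    and w: "\<And>R r. r \<in> {1..R} \<Longrightarrow> \<bar>w R r\<bar> \<le> B * mean_rate ^ (R - r)"
  shows "(\<lambda>k. estimator_mean W (R k) (h k)) \<longlonglongrightarrow> expectation (Y 0)"
proof (rule LIM_zero_cancel, rule Lim_null_comparison)
  let ?K = "B * (2 * strong_const * hmax powr (\<beta> / 2))"
  have "\<forall>\<^sub>F k in sequentially. R k \<ge> 1" using R by (simp add: filterlim_at_top)
  with h show "\<forall>\<^sub>F k in sequentially. norm (estimator_mean W (R k) (h k) - expectation (Y 0))
      \<le> ?K * (real (R k) * mean_rate ^ R k / mean_rate)"
  proof eventually_elim
    case (elim k)
    have "\<bar>estimator_mean W (R k) (h k) - expectation (Y 0)\<bar> \<le> ?K * (real (R k) * mean_rate ^ (R k - 1))"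
      using elim W w1 w by (intro estimator_bias_le[where w = "w (R k)"]) auto
    also have "mean_rate ^ (R k - 1) = mean_rate ^ R k / mean_rate"
      using elim mean_rate by (simp add: power_diff)
    finally show ?case by simp
  qed
  have "(\<lambda>n. real n * mean_rate ^ n) \<longlonglongrightarrow> 0"
    using powser_times_n_limit_0[of mean_rate] mean_rate by simp
  from filterlim_compose[OF this R]
  have "(\<lambda>k. ?K * (real (R k) * mean_rate ^ R k / mean_rate)) \<longlonglongrightarrow> ?K * (0 / mean_rate)"
    using mean_rate by (intro tendsto_intros) auto
  thus "(\<lambda>k. ?K * (real (R k) * mean_rate ^ R k / mean_rate)) \<longlonglongrightarrow> 0" by simp
qed

text \<open>
  The standing assumption \<open>\<beta> \<le> 2 * \<alpha>\<close> says that the weights decay at least as fast as the mean errors.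
\<close>

lemma ml2r_weight_le:
  assumes \<alpha>: "\<alpha> > 0" "2 * \<alpha> \<ge> \<beta>" and r: "r \<in> {1..R}"
  shows "\<bar>ml2r_weight \<alpha> M R r\<bar> \<le> exp (2 / (1 - real M powr (- \<alpha>))\<^sup>2) * mean_rate ^ (R - r)"
proof -
  define g where "g = real M powr (- \<alpha>)"
  have g: "0 < g" "g < 1" using \<alpha> M by (auto simp: g_def powr_less_one)
  have "\<bar>ml2r_weight \<alpha> M R r\<bar> \<le> exp (2 / (1 - g)\<^sup>2) * g ^ (R - r)"
    using ml2r_weight_eq(1)[OF \<alpha>(1) M _ r] geometric_lagrange_weight_le[OF g r] r by (simp add: g_def)
  also have "\<dots> \<le> exp (2 / (1 - g)\<^sup>2) * mean_rate ^ (R - r)"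
  proof (intro mult_left_mono power_mono)
    show "g \<le> mean_rate" unfolding g_def mean_rate_def using M \<alpha> by (intro powr_mono) auto
  qed (use g in auto)
  finally show ?thesis by (simp add: g_def)
qed

end

section \<open>Depth and coarse step for small tolerances\<close>

lemma step_grid_ceiling:
  assumes "x > 0"
  shows "hmax / real_of_int \<lceil>x\<rceil> \<in> step_grid hmax"
proof -
  have n: "\<lceil>x\<rceil> = int (nat \<lceil>x\<rceil>)" "nat \<lceil>x\<rceil> \<ge> 1"
    using assms zero_less_ceiling[of x] by linarith+
  have "hmax / real_of_int \<lceil>x\<rceil> = hmax / real (nat \<lceil>x\<rceil>)"
    using n(1) by (metis of_int_of_nat_eq)
  thus ?thesis unfolding step_grid_def using n(2) by blast
qed

lemma filterlim_nat_ceiling_at_top: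
  fixes f :: "'b \<Rightarrow> real"
  assumes "filterlim f at_top F"
  shows "filterlim (\<lambda>x. nat \<lceil>f x\<rceil>) at_top F"
  unfolding filterlim_at_top
proof
  fix Z :: nat
  have "\<forall>\<^sub>F x in F. real Z \<le> f x" using assms by (simp add: filterlim_at_top)
  thus "\<forall>\<^sub>F x in F. Z \<le> nat \<lceil>f x\<rceil>" by eventually_elim linarith
qed

lemma filterlim_ln_divide_at_top:
  fixes \<epsilon> :: "'b \<Rightarrow> real"
  assumes \<epsilon>: "filterlim \<epsilon> (at_right 0) F" and s: "s > 0"
  shows "filterlim (\<lambda>x. ln (s / \<epsilon> x)) at_top F"
proof -
  have "filterlim (\<lambda>x. s / x) at_top (at_right (0 :: real))"
    using filterlim_tendsto_pos_mult_at_top[OF tendsto_const s filterlim_inverse_at_top_right]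
    by (simp add: divide_inverse)
  from filterlim_compose[OF ln_at_top filterlim_compose[OF this \<epsilon>]] show ?thesis .
qed

lemma mlmc_R_at_top:
  fixes \<epsilon> :: "'b \<Rightarrow> real"
  assumes \<epsilon>: "filterlim \<epsilon> (at_right 0) F" and "\<alpha> > 0" "M \<ge> 2"
  shows "filterlim (\<lambda>x. mlmc_R \<alpha> M hmax c1 (\<epsilon> x)) at_top F"
proof -
  have d: "1 / (\<alpha> * ln (real M)) > 0" using assms by simp
  have "filterlim (\<lambda>x. ln (sqrt (1 + 2 * \<alpha>) / \<epsilon> x)) at_top F"
    using assms by (intro filterlim_ln_divide_at_top) auto
  from filterlim_tendsto_pos_mult_at_top[OF tendsto_const d this]
  have "filterlim (\<lambda>x. ln (sqrt (1 + 2 * \<alpha>) / \<epsilon> x) / (\<alpha> * ln (real M))) at_top F" by simp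
  from filterlim_nat_ceiling_at_top[OF filterlim_tendsto_add_at_top[OF tendsto_const this]]
  show ?thesis unfolding mlmc_R_def .
qed

lemma ml2r_R_at_top:
  fixes \<epsilon> :: "'b \<Rightarrow> real"
  assumes \<epsilon>: "filterlim \<epsilon> (at_right 0) F" and "\<alpha> > 0" "M \<ge> 2"
  shows "filterlim (\<lambda>x. ml2r_R \<alpha> M hmax ct (\<epsilon> x)) at_top F"
proof -
  have d: "2 / (\<alpha> * ln (real M)) > 0" using assms by simp
  have "filterlim (\<lambda>x. ln (sqrt (1 + 4 * \<alpha>) / \<epsilon> x)) at_top F"
    using assms by (intro filterlim_ln_divide_at_top) auto
  from filterlim_tendsto_pos_mult_at_top[OF tendsto_const d this]
  have "filterlim (\<lambda>x. 2 * ln (sqrt (1 + 4 * \<alpha>) / \<epsilon> x) / (\<alpha> * ln (real M))) at_top F" by simp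
  from filterlim_compose[OF sqrt_at_top filterlim_tendsto_add_at_top[OF tendsto_const this]]
  have "filterlim (\<lambda>x. sqrt (k\<^sup>2 + 2 * ln (sqrt (1 + 4 * \<alpha>) / \<epsilon> x) / (\<alpha> * ln (real M)))) at_top F" for k .
  from filterlim_nat_ceiling_at_top[OF filterlim_tendsto_add_at_top[OF tendsto_const this]]
  show ?thesis unfolding ml2r_R_def Let_def .
qed

lemma mlmc_h_in_step_grid:
  assumes "hmax > 0" "M \<ge> 1" "\<alpha> > 0" "c1 \<noteq> 0" "\<epsilon> > 0"
  shows "mlmc_h \<alpha> M hmax c1 \<epsilon> \<in> step_grid hmax"
  unfolding mlmc_h_def Let_def
  using assms by (intro step_grid_ceiling mult_pos_pos) (auto simp: add_pos_pos)

lemma ml2r_h_in_step_grid: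
  assumes "hmax > 0" "M \<ge> 1" "\<alpha> > 0" "ct > 0" "\<epsilon> > 0"
  shows "ml2r_h \<alpha> M hmax ct \<epsilon> \<in> step_grid hmax"
proof -
  have "1 + 2 * \<alpha> * real n > 0" for n using assms by (intro add_pos_nonneg) auto
  thus ?thesis unfolding ml2r_h_def Let_def
    using assms by (intro step_grid_ceiling mult_pos_pos) (auto simp: less_imp_neq[THEN not_sym])
qed

section \<open>Almost sure convergence\<close>

theorem theorem3p1:
  fixes P :: "'a measure"
    and hmax :: real
    and Y :: "real \<Rightarrow> 'a \<Rightarrow> real"
    and Yc :: "nat \<Rightarrow> nat \<Rightarrow> real \<Rightarrow> 'a \<Rightarrow> real"
    and M :: nat
    and p \<alpha> \<beta> V1 Vp :: real
    and c :: "nat \<Rightarrow> real"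
    and \<epsilon> :: "nat \<Rightarrow> real"
  assumes "prob_space P"
    and "hmax > 0"
    and "M \<ge> 2"
    and "\<And>h. h \<in> insert 0 (step_grid hmax) \<Longrightarrow> Y h \<in> borel_measurable P"
    and "\<And>h. h \<in> insert 0 (step_grid hmax) \<Longrightarrow> integrable P (\<lambda>\<omega>. (Y h \<omega>)\<^sup>2)"
    and "prob_space.variance P (Y 0) > 0"
    and "((\<lambda>h. sqrt (\<integral>\<omega>. (Y h \<omega> - Y 0 \<omega>)\<^sup>2 \<partial>P)) \<longlongrightarrow> 0) (at 0 within step_grid hmax)"
    and "independent_copies P hmax Y Yc"
    and "p \<ge> 2"
    and "\<alpha> > 0"
    and "\<And>Rb. Rb \<ge> 1 \<Longrightarrow> weak_error P hmax Y \<alpha> c Rb"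
    and "integrable P (\<lambda>\<omega>. \<bar>Y 0 \<omega>\<bar> powr p)"
    and "\<beta> > 0"
    and "Vp \<ge> 0"
    and "strong_error P hmax Y p \<beta> Vp"
    and "V1 > 0"
    and "strong_error P hmax Y 2 \<beta> V1"
    and "2 * \<alpha> \<ge> \<beta>"
    and "\<And>k. \<epsilon> k > 0"
    and "summable (\<lambda>k. \<epsilon> k powr p)"
  shows
    "(c 1 \<noteq> 0 \<longrightarrow>
        (AE \<omega> in P. (\<lambda>k. mlmc_estimator Yc M hmax \<alpha> \<beta> V1 (prob_space.variance P (Y 0)) (c 1) (\<epsilon> k) \<omega>)
           \<longlonglongrightarrow> prob_space.expectation P (Y 0))) \<and>
     (\<forall>ct>0. (\<lambda>R. root R \<bar>c R\<bar>) \<longlonglongrightarrow> ct \<longrightarrow>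
        (AE \<omega> in P. (\<lambda>k. ml2r_estimator Yc M hmax \<alpha> \<beta> V1 (prob_space.variance P (Y 0)) ct (\<epsilon> k) \<omega>)
           \<longlonglongrightarrow> prob_space.expectation P (Y 0)))"
proof -
  interpret prob_space P by fact
  interpret multilevel_model P hmax Y Yc M p \<beta> Vp
    by unfold_locales (use assms in auto)
  have M1: "M \<ge> 1" using \<open>M \<ge> 2\<close> by simp
  define v where "v = variance (Y 0)"
  define \<theta> where "\<theta> = sqrt (V1 / v)"
  have v: "v > 0" unfolding v_def by fact
  have \<theta>: "\<theta> > 0" using v \<open>V1 > 0\<close> by (simp add: \<theta>_def)
  have "(\<lambda>k. \<epsilon> k powr p) \<longlonglongrightarrow> 0" by (rule summable_LIMSEQ_zero) fact
  hence "(\<lambda>k. (\<epsilon> k powr p) powr (1 / p)) \<longlonglongrightarrow> 0 powr (1 / p)"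
    using \<open>p \<ge> 2\<close> by (intro tendsto_powr') (auto intro: tendsto_const)
  hence "\<epsilon> \<longlonglongrightarrow> 0" using \<open>p \<ge> 2\<close> \<open>\<And>k. \<epsilon> k > 0\<close> by (simp add: powr_powr less_imp_le)
  hence \<epsilon>0: "filterlim \<epsilon> (at_right 0) sequentially"
    using \<open>\<And>k. \<epsilon> k > 0\<close> by (simp add: filterlim_at less_imp_neq[THEN not_sym])
  have "AE \<omega> in P. (\<lambda>k. mlmc_estimator Yc M hmax \<alpha> \<beta> V1 v (c 1) (\<epsilon> k) \<omega>) \<longlonglongrightarrow> expectation (Y 0)"
    if c1: "c 1 \<noteq> 0"
  proof -
    let ?R = "\<lambda>k. mlmc_R \<alpha> M hmax (c 1) (\<epsilon> k)" and ?h = "\<lambda>k. mlmc_h \<alpha> M hmax (c 1) (\<epsilon> k)"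
    have R: "filterlim ?R at_top sequentially" using \<epsilon>0 \<open>\<alpha> > 0\<close> \<open>M \<ge> 2\<close> by (rule mlmc_R_at_top)
    have R1: "\<forall>\<^sub>F k in sequentially. ?R k \<ge> 1" using R by (simp add: filterlim_at_top)
    have h: "?h k \<in> step_grid hmax" for k using \<open>hmax > 0\<close> M1 \<open>\<alpha> > 0\<close> c1 \<open>\<And>k. \<epsilon> k > 0\<close> by (rule mlmc_h_in_step_grid)
    have mean: "(\<lambda>k. estimator_mean mlmc_W (?R k) (?h k)) \<longlonglongrightarrow> expectation (Y 0)"
      \<comment> \<open>Unit weights on all corrections are the tails of a unit mass at the finest level.\<close>
    proof (rule estimator_mean_tendsto[OF R, where w = "\<lambda>R r. if r = R then 1 else 0" and B = 1])
      show "\<bar>if r = R then 1 else 0\<bar> \<le> 1 * mean_rate ^ (R - r)" for R r using mean_rate by simp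
    qed (use h in \<open>auto simp: mlmc_W_def\<close>)
    show ?thesis unfolding mlmc_estimator_def Let_def \<theta>_def[symmetric]
    proof (rule estimator_tendsto_AE[OF \<theta> v \<open>\<And>k. \<epsilon> k > 0\<close> _ \<open>summable (\<lambda>k. \<epsilon> k powr p)\<close> mean])
      show "\<forall>\<^sub>F k in sequentially. ?R k \<ge> 1 \<and> ?h k \<in> step_grid hmax \<and> 1 \<le> 1 + 1 / (2 * \<alpha>)"
        using R1 by eventually_elim (use h \<open>\<alpha> > 0\<close> in auto)
    qed
  qed
  moreover have "AE \<omega> in P. (\<lambda>k. ml2r_estimator Yc M hmax \<alpha> \<beta> V1 v ct (\<epsilon> k) \<omega>) \<longlonglongrightarrow> expectation (Y 0)"
    if ct: "ct > 0" for ct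
  proof -
    let ?R = "\<lambda>k. ml2r_R \<alpha> M hmax ct (\<epsilon> k)" and ?h = "\<lambda>k. ml2r_h \<alpha> M hmax ct (\<epsilon> k)"
    have R: "filterlim ?R at_top sequentially" using \<epsilon>0 \<open>\<alpha> > 0\<close> \<open>M \<ge> 2\<close> by (rule ml2r_R_at_top)
    have R1: "\<forall>\<^sub>F k in sequentially. ?R k \<ge> 1" using R by (simp add: filterlim_at_top)
    have h: "?h k \<in> step_grid hmax" for k using \<open>hmax > 0\<close> M1 \<open>\<alpha> > 0\<close> ct \<open>\<And>k. \<epsilon> k > 0\<close> by (rule ml2r_h_in_step_grid)
    have mean: "(\<lambda>k. estimator_mean (ml2r_W \<alpha> M) (?R k) (?h k)) \<longlonglongrightarrow> expectation (Y 0)"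
    proof (rule estimator_mean_tendsto[OF R])
      show "\<bar>ml2r_weight \<alpha> M R r\<bar> \<le> exp (2 / (1 - real M powr (- \<alpha>))\<^sup>2) * mean_rate ^ (R - r)"
        if "r \<in> {1..R}" for R r
        using \<open>\<alpha> > 0\<close> \<open>2 * \<alpha> \<ge> \<beta>\<close> that by (rule ml2r_weight_le)
      show "(\<Sum>r=1..R. ml2r_weight \<alpha> M R r) = 1" if "R \<ge> 1" for R
        using \<open>\<alpha> > 0\<close> \<open>M \<ge> 2\<close> that by (rule ml2r_weight_eq(2))
    qed (use h in \<open>auto simp: ml2r_W_def\<close>)
    show ?thesis unfolding ml2r_estimator_def Let_def \<theta>_def[symmetric]
    proof (rule estimator_tendsto_AE[OF \<theta> v \<open>\<And>k. \<epsilon> k > 0\<close> _ \<open>summable (\<lambda>k. \<epsilon> k powr p)\<close> mean])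
      show "\<forall>\<^sub>F k in sequentially. ?R k \<ge> 1 \<and> ?h k \<in> step_grid hmax \<and> 1 \<le> 1 + 1 / (2 * \<alpha> * real (?R k))"
        using R1 by eventually_elim (use h \<open>\<alpha> > 0\<close> in auto)
    qed
  qed
  ultimately show ?thesis unfolding v_def by blast
qed

end
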